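(* Let $d\ge2$ and let $\mathcal Q_l=(0,l_1)\times\cdots\times(0,l_{d-1})\times(0,1)\subset\mathbb R^d$ with $l_j>0$ and $l_j^2\notin\mathbb Q$ for at least one $1\le j\le d-1$. Fix any ball $B\subset\mathbb R^d$ and either Dirichlet or Neumann boundary conditions. Then the inverse localization property fails strongly on $\mathcal Q_l$, i.e. the set $$\mathcal N=\Big\{\varphi\in\mathrm{MW}^{\mathrm s}:\ \inf_{z^0\in\mathcal Q_l}\ \inf_{\lambda\in\Lambda}\ \inf_{u_\lambda\in\mathcal V^\lambda}\Big\|\varphi-u_\lambda\Big(z^0+\frac{\cdot}{\sqrt\lambda}\Big)\Big\|_{C^0(B)}>0\Big\}$$ is open and dense in $\mathrm{MW}^{\mathrm s}$.
   Context: $\mathrm{MW}=\{\varphi\in C^\infty(\mathbb R^d,\mathbb R):\Delta\varphi+\varphi=0\}$; $\mathrm{MW}^{\mathrm s}=\{f\in\mathrm{MW}:\ |z|^{(d-1)/2}f(z)\in L^\infty(\mathbb R^d)\}$, a Banach space with norm $\|f\|=\sup_z(1+|z|)^{(d-1)/2}|f(z)|$; openness and density refer to this norm. $\Lambda$ is the set of eigenvalues of $\Delta u+\lambda u=0$ in $\mathcal Q_l$ with the chosen boundary condition and $\mathcal V^\lambda$ the real eigenspace of $\lambda$ (eigenfunctions being products of sines, resp. cosines, hence defined on all of $\mathbb R^d$). *)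

theory Defs
  imports "HOL-Analysis.Analysis"
begin

definition partial :: "'n::finite \<Rightarrow> (real^'n \<Rightarrow> real) \<Rightarrow> real^'n \<Rightarrow> real" where
  "partial i f z = deriv (\<lambda>t. f (z + t *\<^sub>R axis i 1)) 0"

fun Ck :: "nat \<Rightarrow> (real^'n::finite \<Rightarrow> real) \<Rightarrow> bool" where
  "Ck 0 f = continuous_on UNIV f"
| "Ck (Suc k) f = (continuous_on UNIV f \<and>
      (\<forall>i z. (\<lambda>t. f (z + t *\<^sub>R axis i 1)) differentiable (at 0)) \<and>
      (\<forall>i. Ck k (partial i f)))"

definition smooth :: "(real^'n::finite \<Rightarrow> real) \<Rightarrow> bool" where
  "smooth f \<longleftrightarrow> (\<forall>k. Ck k f)"

definition laplacian :: "(real^'n::finite \<Rightarrow> real) \<Rightarrow> real^'n \<Rightarrow> real" where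
  "laplacian f z = (\<Sum>i\<in>UNIV. partial i (partial i f) z)"

definition MW :: "(real^'n::finite \<Rightarrow> real) set" where
  "MW = {\<phi>. smooth \<phi> \<and> (\<forall>z. laplacian \<phi> z + \<phi> z = 0)}"

definition ws_norm :: "(real^'n::finite \<Rightarrow> real) \<Rightarrow> real" where
  "ws_norm f = (SUP z. (1 + norm z) powr ((real CARD('n) - 1) / 2) * \<bar>f z\<bar>)"

text \<open>MW^s: waves with |z|^((d-1)/2) f bounded (equivalently, finite weighted norm;
  f is continuous, so L^infty-boundedness is pointwise boundedness).\<close>
definition MWs :: "(real^'n::finite \<Rightarrow> real) set" where
  "MWs = {f\<in>MW. \<exists>C. \<forall>z. (1 + norm z) powr ((real CARD('n) - 1) / 2) * \<bar>f z\<bar> \<le> C}"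

datatype bc = Dirichlet | Neumann

definition box_Q :: "('n::finite \<Rightarrow> real) \<Rightarrow> (real^'n) set" where
  "box_Q l = {z. \<forall>j. 0 < z $ j \<and> z $ j < l j}"

definition admissible :: "bc \<Rightarrow> ('n::finite \<Rightarrow> nat) \<Rightarrow> bool" where
  "admissible b m = (b = Neumann \<or> (\<forall>j. 1 \<le> m j))"

definition mode_eig :: "('n::finite \<Rightarrow> real) \<Rightarrow> ('n \<Rightarrow> nat) \<Rightarrow> real" where
  "mode_eig l m = (\<Sum>j\<in>UNIV. (pi * real (m j) / l j)\<^sup>2)"

definition mode_fun :: "bc \<Rightarrow> ('n::finite \<Rightarrow> real) \<Rightarrow> ('n \<Rightarrow> nat) \<Rightarrow> real^'n \<Rightarrow> real" where
  "mode_fun b l m z = (\<Prod>j\<in>UNIV. (case b of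
       Dirichlet \<Rightarrow> sin (pi * real (m j) * z $ j / l j)
     | Neumann \<Rightarrow> cos (pi * real (m j) * z $ j / l j)))"

text \<open>Lambda: the (positive) eigenvalues of Delta u + lambda u = 0 in Q_l with the boundary condition.\<close>
definition eigenvalues :: "bc \<Rightarrow> ('n::finite \<Rightarrow> real) \<Rightarrow> real set" where
  "eigenvalues b l = {lam. 0 < lam \<and> (\<exists>m. admissible b m \<and> mode_eig l m = lam)}"

definition eigenspace :: "bc \<Rightarrow> ('n::finite \<Rightarrow> real) \<Rightarrow> real \<Rightarrow> (real^'n \<Rightarrow> real) set" where
  "eigenspace b l lam = {u. \<exists>F c. finite F \<and> (\<forall>m\<in>F. admissible b m \<and> mode_eig l m = lam) \<and>
       u = (\<lambda>z. \<Sum>m\<in>F. c m * mode_fun b l m z)}"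

definition C0_norm_on :: "(real^'n::finite) set \<Rightarrow> (real^'n \<Rightarrow> real) \<Rightarrow> real" where
  "C0_norm_on B f = (SUP x\<in>B. \<bar>f x\<bar>)"

definition N_set :: "bc \<Rightarrow> ('n::finite \<Rightarrow> real) \<Rightarrow> (real^'n) set \<Rightarrow> (real^'n \<Rightarrow> real) set" where
  "N_set b l B = {\<phi>\<in>MWs. 0 < (INF z0\<in>box_Q l. INF lam\<in>eigenvalues b l. INF u\<in>eigenspace b l lam.
        C0_norm_on B (\<lambda>x. \<phi> x - u (z0 + (1 / sqrt lam) *\<^sub>R x)))}"

definition open_in_MWs :: "(real^'n::finite \<Rightarrow> real) set \<Rightarrow> bool" where
  "open_in_MWs S \<longleftrightarrow> S \<subseteq> MWs \<and>
     (\<forall>\<phi>\<in>S. \<exists>\<epsilon>>0. \<forall>\<psi>\<in>MWs. ws_norm (\<lambda>z. \<psi> z - \<phi> z) < \<epsilon> \<longrightarrow> \<psi> \<in> S)"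

definition dense_in_MWs :: "(real^'n::finite \<Rightarrow> real) set \<Rightarrow> bool" where
  "dense_in_MWs S \<longleftrightarrow> (\<forall>\<phi>\<in>MWs. \<forall>\<epsilon>>0. \<exists>\<psi>\<in>S. ws_norm (\<lambda>z. \<psi> z - \<phi> z) < \<epsilon>)"

end

theory Submission
  imports Defs
begin

text \<open>Since l_j^2 is irrational for some j, there is a rational-linear functional T on the reals with
  T(1) = 1 and T(1/l_j^2) = 0. Applying T to the eigenvalue relation, the sum of m_i^2/l_i^2 being
  constant, shows that all frequencies of a rescaled eigenfunction v lie on a quadric: with
  alpha_i = l_i^2 T(1/l_i^2) and P the sum of alpha_i times the second derivative in direction i,
  P v = - a v for a constant a bounded independently of the eigenvalue. Here alpha_k = 1 and
  alpha_j = 0, so P is not a multiple of the Laplacian. Testing against a compactly supported bump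
  shows that uniform limits on the ball inherit the equation, hence every wave outside N satisfies
  P phi = - a phi on the ball for some a. If chi is the radial wave centred in the ball, chi, P chi
  and P^2 chi are linearly independent there, and then phi and phi + t chi cannot both be
  eigenfunctions of P; this gives density. Openness is the triangle inequality.\<close>

section \<open>Second derivatives in the weak sense\<close>

text \<open>Exclusion from N has to be handled for infinitely many eigenvalues, all base points and
  whole eigenspaces at once. An equation whose only eigenvalue-dependent datum is a scalar makes
  this possible, provided that the scalars stay in a compact set. This is not automatic: T is
  additive but discontinuous, so its values at large eigenvalues are uncontrolled. The bound comes
  from the rescaling instead: the squared frequencies are nonnegative and sum to 1, so a is a
  weighted average of the \<alpha>_i. The second obstacle is that uniform closeness on a ball gives
  no control of derivatives, although P is of second order. Hence the derivatives are moved onto a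
  bump function. The radial wave serves as perturbation because it is explicit enough for computing
  P twice and decays at exactly the rate that the weighted norm requires.\<close>

lemma partialI:
  assumes "((\<lambda>t. f (z + t *\<^sub>R axis i 1)) has_real_derivative D) (at 0)"
  shows "partial i f z = D"
  unfolding partial_def using assms by (rule DERIV_imp_deriv)

lemma DERIV_along_axis:
  assumes "Ck (Suc k) f"
  shows "((\<lambda>t. f (z + t *\<^sub>R axis i 1)) has_real_derivative partial i f (z + t *\<^sub>R axis i 1)) (at t)"
proof -
  have "(\<lambda>s. f ((z + t *\<^sub>R axis i 1) + s *\<^sub>R axis i 1)) differentiable (at 0)"
    using assms by simp
  then have "((\<lambda>s. f ((z + t *\<^sub>R axis i 1) + s *\<^sub>R axis i 1)) has_real_derivative
      partial i f (z + t *\<^sub>R axis i 1)) (at 0)"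
    unfolding partial_def by (simp add: DERIV_deriv_iff_real_differentiable)
  then have "((\<lambda>s. f (z + (s + t) *\<^sub>R axis i 1)) has_real_derivative
      partial i f (z + t *\<^sub>R axis i 1)) (at 0)"
    by (simp add: algebra_simps)
  then show ?thesis
    using DERIV_shift[of "\<lambda>s. f (z + s *\<^sub>R axis i 1)" _ 0 t] by simp
qed

lemma integrable_continuous_compact_support:
  fixes g :: "real^'n::finite \<Rightarrow> real"
  assumes "continuous_on UNIV g" "\<And>z. z \<notin> cball x R \<Longrightarrow> g z = 0"
  shows "integrable lborel g"
proof -
  have "integrable lborel (\<lambda>z. indicator (cball x R) z *\<^sub>R g z)"
    by (rule borel_integrable_compact) (auto intro: continuous_on_subset[OF assms(1)])
  moreover have "(\<lambda>z. indicator (cball x R) z *\<^sub>R g z) = g"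
    using assms(2) by (auto simp: indicator_def fun_eq_iff)
  ultimately show ?thesis by simp
qed

text \<open>By translation invariance of Lebesgue measure, the difference quotients of
  \<open>g\<close> integrate to 0, and dominated convergence carries this over to \<open>g'\<close>.
  No iterated integrals are involved.\<close>

lemma integral_derivative_compact_support:
  fixes g g' :: "real^'n::finite \<Rightarrow> real"
  assumes g: "continuous_on UNIV g" "\<And>z. z \<notin> cball x R \<Longrightarrow> g z = 0"
    and g': "continuous_on UNIV g'" "\<And>z. z \<notin> cball x R \<Longrightarrow> g' z = 0"
    and D: "\<And>z t. ((\<lambda>t. g (z + t *\<^sub>R axis i 1)) has_real_derivative g' (z + t *\<^sub>R axis i 1)) (at t)"
  shows "integral\<^sup>L lborel g' = 0"
proof -
  define h where "h n = 1 / real (Suc n)" for n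
  have h: "0 < h n" "h n \<le> 1" for n by (auto simp: h_def)
  have hlim: "h \<longlonglongrightarrow> 0" unfolding h_def using LIMSEQ_inverse_real_of_nat by (simp add: inverse_eq_divide)
  let ?e = "axis i 1 :: real^'n"
  define G where "G n z = (g (z + h n *\<^sub>R ?e) - g z) / h n" for n z
  have bdd: "bounded (g' ` cball x R)"
    by (intro compact_imp_bounded compact_continuous_image continuous_on_subset[OF g'(1)]) auto
  then obtain M where M: "\<And>z. z \<in> cball x R \<Longrightarrow> \<bar>g' z\<bar> \<le> M"
    unfolding bounded_iff by (metis imageI real_norm_def)
  have M': "\<bar>g' z\<bar> \<le> max M 0" for z
    by (cases "z \<in> cball x R") (use M g'(2) in force)+
  have int_g: "integrable lborel g" by (rule integrable_continuous_compact_support[OF g])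
  have shift: "integrable lborel (\<lambda>z. g (z + v)) \<and> integral\<^sup>L lborel (\<lambda>z. g (z + v)) = integral\<^sup>L lborel g" for v
  proof -
    have "integrable (distr lborel borel ((+) v)) g" using int_g by (simp add: lborel_distr_plus)
    then have "integrable lborel (\<lambda>z. g (v + z))"
      by (subst (asm) integrable_distr_eq) (use g in \<open>auto intro: borel_measurable_continuous_onI\<close>)
    moreover have "integral\<^sup>L lborel g = integral\<^sup>L (distr lborel borel ((+) v)) g" by (simp add: lborel_distr_plus)
    then have "integral\<^sup>L lborel g = integral\<^sup>L lborel (\<lambda>z. g (v + z))"
      by (subst (asm) integral_distr) (use g in \<open>auto intro: borel_measurable_continuous_onI\<close>)
    ultimately show ?thesis by (simp add: add.commute)
  qed
  have G0: "integral\<^sup>L lborel (G n) = 0" for n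
    unfolding G_def using shift[of "h n *\<^sub>R ?e"] int_g by (simp add: Bochner_Integration.integral_diff)
  \<comment> \<open>All steps satisfy \<open>h n \<le> 1\<close>, so the difference quotients are
    supported in the ball enlarged by 1. The mean value theorem bounds them there by the supremum of
    \<open>g'\<close>.\<close>
  have "(\<lambda>n. integral\<^sup>L lborel (G n)) \<longlonglongrightarrow> integral\<^sup>L lborel g'"
  proof (rule integral_dominated_convergence[where w = "\<lambda>z. indicator (cball x (R + 1)) z *\<^sub>R max M 0"])
    show "g' \<in> borel_measurable lborel" using g' by (auto intro: borel_measurable_continuous_onI)
    have "continuous_on UNIV (G n)" for n
      unfolding G_def using h(1)[of n]
      by (intro continuous_intros continuous_on_compose2[OF g(1)]) auto
    then show "G n \<in> borel_measurable lborel" for n by (auto intro: borel_measurable_continuous_onI)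
    show "integrable lborel (\<lambda>z. indicator (cball x (R + 1)) z *\<^sub>R max M 0)"
      by (rule borel_integrable_compact) auto
    have "(\<lambda>n. G n z) \<longlonglongrightarrow> g' z" for z
    proof -
      have "((\<lambda>t. (g (z + t *\<^sub>R ?e) - g z) / t) \<longlongrightarrow> g' z) (at 0)"
        using D[of z 0] by (simp add: has_field_derivative_iff)
      moreover have "filterlim h (at 0) sequentially"
        using hlim h(1) by (auto simp: filterlim_at less_imp_neq[symmetric] intro!: always_eventually)
      ultimately show ?thesis unfolding G_def by (rule filterlim_compose)
    qed
    then show "AE z in lborel. (\<lambda>n. G n z) \<longlonglongrightarrow> g' z" by simp
    have "norm (G n z) \<le> indicator (cball x (R + 1)) z *\<^sub>R max M 0" for n z
    proof (cases "z \<in> cball x (R + 1)")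
      case True
      obtain s where "g (z + h n *\<^sub>R ?e) - g (z + 0 *\<^sub>R ?e) = (h n - 0) * g' (z + s *\<^sub>R ?e)"
        using MVT2[of 0 "h n" "\<lambda>t. g (z + t *\<^sub>R ?e)" "\<lambda>t. g' (z + t *\<^sub>R ?e)"] D h(1)[of n] by blast
      then have "G n z = g' (z + s *\<^sub>R ?e)" using h(1)[of n] by (simp add: G_def)
      then show ?thesis using True M'[of "z + s *\<^sub>R ?e"] by simp
    next
      case False
      have "dist x z \<le> dist x (z + h n *\<^sub>R ?e) + dist (z + h n *\<^sub>R ?e) z" by (rule dist_triangle)
      also have "dist (z + h n *\<^sub>R ?e) z \<le> 1" using h[of n] by (simp add: dist_norm)
      finally have "z + h n *\<^sub>R ?e \<notin> cball x R" using False by simp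
      moreover have "z \<notin> cball x R" using False by simp
      ultimately show ?thesis using g(2) False by (simp add: G_def)
    qed
    then show "AE z in lborel. norm (G n z) \<le> indicator (cball x (R + 1)) z *\<^sub>R max M 0" for n by simp
  qed
  then show ?thesis using G0 by (simp add: LIMSEQ_const_iff)
qed

text \<open>\<open>bump 3\<close> is twice continuously differentiable, as needed to integrate by parts twice.\<close>

definition bump :: "nat \<Rightarrow> real^'n::finite \<Rightarrow> real \<Rightarrow> real^'n \<Rightarrow> real" where
  "bump m x \<rho> z = max 0 (\<rho>\<^sup>2 - (norm (z - x))\<^sup>2) ^ m"

lemma DERIV_max0_power:
  fixes t :: real
  assumes "m \<ge> 2"
  shows "((\<lambda>t. max 0 t ^ m) has_real_derivative real m * max 0 t ^ (m - 1)) (at t)"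
proof -
  consider "t > 0" | "t < 0" | "t = 0" by linarith
  then show ?thesis
  proof cases
    case 1
    have "((\<lambda>t. t ^ m) has_real_derivative real m * t ^ (m - 1)) (at t)"
      by (auto intro!: derivative_eq_intros)
    then have "((\<lambda>t. max 0 t ^ m) has_real_derivative real m * t ^ (m - 1)) (at t)"
      by (rule has_field_derivative_transform_within_open[where S = "{0<..}"]) (use 1 in auto)
    then show ?thesis using 1 by simp
  next
    case 2
    have "((\<lambda>t. 0) has_real_derivative 0) (at t)" by simp
    then have "((\<lambda>t. max 0 t ^ m) has_real_derivative 0) (at t)"
      by (rule has_field_derivative_transform_within_open[where S = "{..<0}"]) (use 2 assms in auto)
    then show ?thesis using 2 assms by (simp add: power_0_left)
  next
    case 3
    \<comment> \<open>At the kink the difference quotient is dominated by a positive power of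
      \<open>max 0 s\<close>, which tends to 0. This is where \<open>m \<ge> 2\<close>
      enters.\<close>
    obtain k where k: "m = Suc (Suc k)" using le_Suc_ex[OF assms] by auto
    have "((\<lambda>s. max 0 s ^ Suc k) \<longlongrightarrow> max 0 0 ^ Suc k) (at (0::real))"
      by (intro tendsto_intros)
    then have lim: "((\<lambda>s. max 0 s ^ Suc k) \<longlongrightarrow> 0) (at (0::real))" by simp
    have "((\<lambda>s. (max 0 s ^ m - max 0 0 ^ m) / (s - 0)) \<longlongrightarrow> 0) (at (0::real))"
    proof (rule Lim_null_comparison[OF _ lim], rule always_eventually, rule allI)
      fix s :: real
      show "norm ((max 0 s ^ m - max 0 0 ^ m) / (s - 0)) \<le> max 0 s ^ Suc k"
        by (cases "s > 0") (auto simp: k max_def)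
    qed
    then show ?thesis using 3 k by (simp add: has_field_derivative_iff)
  qed
qed

lemma DERIV_norm_sq_axis:
  fixes z x :: "real^'n::finite"
  shows "((\<lambda>t. (norm (z + t *\<^sub>R axis i 1 - x))\<^sup>2) has_real_derivative 2 * ((z + t *\<^sub>R axis i 1 - x) $ i)) (at t)"
proof -
  have "(norm (z + t *\<^sub>R axis i 1 - x))\<^sup>2 = (norm (z - x))\<^sup>2 + 2 * t * ((z - x) $ i) + t\<^sup>2" for t
  proof -
    have 1: "z + t *\<^sub>R axis i 1 - x = (z - x) + t *\<^sub>R axis i 1" by simp
    have 2: "(norm (w + t *\<^sub>R axis i 1))\<^sup>2 = (norm w)\<^sup>2 + 2 * t * (w $ i) + t\<^sup>2" for w :: "real^'n"
      unfolding power2_norm_eq_inner inner_add_left inner_add_right inner_scaleR_left inner_scaleR_right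
      by (simp add: inner_axis inner_axis' power2_eq_square algebra_simps)
    show ?thesis unfolding 1 by (rule 2)
  qed
  then have eq: "(\<lambda>t. (norm (z + t *\<^sub>R axis i 1 - x))\<^sup>2) =
      (\<lambda>t. (norm (z - x))\<^sup>2 + 2 * t * ((z - x) $ i) + t\<^sup>2)"
    by (rule ext)
  show ?thesis unfolding eq by (auto intro!: derivative_eq_intros)
qed

lemma DERIV_bump:
  assumes "m \<ge> 2"
  shows "((\<lambda>t. bump m x \<rho> (z + t *\<^sub>R axis i 1)) has_real_derivative
     - 2 * real m * ((z + t *\<^sub>R axis i 1 - x) $ i) * bump (m - 1) x \<rho> (z + t *\<^sub>R axis i 1)) (at t)"
  unfolding bump_def
  by (rule DERIV_cong[OF DERIV_chain2[OF DERIV_max0_power[OF assms]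
        DERIV_diff[OF DERIV_const DERIV_norm_sq_axis]]]) (simp add: algebra_simps)

lemma continuous_on_bump [continuous_intros]: "continuous_on S (bump m x \<rho>)"
  unfolding bump_def by (intro continuous_intros)

lemma bump_eq_0: "\<rho> > 0 \<Longrightarrow> m > 0 \<Longrightarrow> z \<notin> cball x \<rho> \<Longrightarrow> bump m x \<rho> z = 0"
  by (auto simp: bump_def dist_norm norm_minus_commute max_def power2_le_iff_abs_le abs_le_square_iff[symmetric])

lemma Ck_2D:
  assumes "Ck 2 f"
  shows "Ck (Suc 0) f" "Ck (Suc 0) (partial i f)"
    "continuous_on UNIV f" "continuous_on UNIV (partial i f)" "continuous_on UNIV (partial i (partial i f))"
  using assms by (simp_all add: numeral_2_eq_2)

text \<open>The second derivative of \<open>bump 3\<close> in direction i. Differentiating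
  \<open>bump 3\<close> gives the factor -6 times the coordinate, and differentiating
  \<open>bump 2\<close> a further factor -4 times the coordinate, whence 24.\<close>

definition bump_deriv2 :: "'n \<Rightarrow> real^'n::finite \<Rightarrow> real \<Rightarrow> real^'n \<Rightarrow> real" where
  "bump_deriv2 i x \<rho> z = 24 * ((z - x) $ i)\<^sup>2 * bump 1 x \<rho> z - 6 * bump 2 x \<rho> z"

lemma integral_bump_partial2:
  fixes x :: "real^'n::finite"
  assumes "Ck 2 f" "\<rho> > 0"
  shows "(LINT z|lborel. bump 3 x \<rho> z * partial i (partial i f) z) = (LINT z|lborel. bump_deriv2 i x \<rho> z * f z)"
proof -
  note C = Ck_2D[OF assms(1)]
  have cb: "continuous_on UNIV (bump m x \<rho>)" for m by (rule continuous_on_bump)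
  define b1 where "b1 z = - 6 * ((z - x) $ i) * bump 2 x \<rho> z" for z
  have cb1: "continuous_on UNIV b1" unfolding b1_def by (intro continuous_intros cb)
  have cb2: "continuous_on UNIV (bump_deriv2 i x \<rho>)" unfolding bump_deriv2_def by (intro continuous_intros cb)
  have z: "bump 3 x \<rho> z = 0" "b1 z = 0" "bump_deriv2 i x \<rho> z = 0" if "z \<notin> cball x \<rho>" for z
    using that assms(2) by (simp_all add: b1_def bump_deriv2_def bump_eq_0)
  have D0: "((\<lambda>t. bump 3 x \<rho> (z + t *\<^sub>R axis i 1)) has_real_derivative b1 (z + t *\<^sub>R axis i 1)) (at t)" for z t
    using DERIV_bump[of 3 x \<rho> z i t] by (simp add: b1_def)
  have Dl: "((\<lambda>t. - 6 * ((z + t *\<^sub>R axis i 1 - x) $ i)) has_real_derivative - 6) (at t)" for z t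
    by (auto intro!: derivative_eq_intros)
  have D1: "((\<lambda>t. b1 (z + t *\<^sub>R axis i 1)) has_real_derivative bump_deriv2 i x \<rho> (z + t *\<^sub>R axis i 1)) (at t)" for z t
    unfolding b1_def bump_deriv2_def
    by (rule DERIV_cong[OF DERIV_mult[OF Dl DERIV_bump]]) (simp_all add: power2_eq_square algebra_simps)
  have I: "integrable lborel (\<lambda>z. g z * k z)"
    if "continuous_on UNIV g" "\<And>z. z \<notin> cball x \<rho> \<Longrightarrow> g z = 0" "continuous_on UNIV k" for g k :: "real^'n \<Rightarrow> real"
    by (rule integrable_continuous_compact_support[where x = x and R = \<rho>]) (use that in \<open>auto intro!: continuous_intros\<close>)
  \<comment> \<open>The integrand is the derivative of a compactly supported product. The same
    argument with \<open>b1\<close> in place of the bump performs the second integration by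
    parts.\<close>
  have "0 = (LINT z|lborel. bump 3 x \<rho> z * partial i (partial i f) z + b1 z * partial i f z)"
    by (rule integral_derivative_compact_support[where i = i and x = x and R = \<rho> and g = "\<lambda>z. bump 3 x \<rho> z * partial i f z", symmetric])
       (auto intro!: continuous_intros C cb cb1 derivative_eq_intros D0 DERIV_along_axis simp: z)
  then have 1: "(LINT z|lborel. bump 3 x \<rho> z * partial i (partial i f) z) = - (LINT z|lborel. b1 z * partial i f z)"
    by (subst (asm) Bochner_Integration.integral_add) (auto intro!: I cb cb1 C simp: z)
  have "0 = (LINT z|lborel. b1 z * partial i f z + bump_deriv2 i x \<rho> z * f z)"
    by (rule integral_derivative_compact_support[where i = i and x = x and R = \<rho> and g = "\<lambda>z. b1 z * f z", symmetric])
       (auto intro!: continuous_intros C cb2 cb1 derivative_eq_intros D1 DERIV_along_axis simp: z)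
  then have 2: "(LINT z|lborel. bump_deriv2 i x \<rho> z * f z) = - (LINT z|lborel. b1 z * partial i f z)"
    by (subst (asm) Bochner_Integration.integral_add) (auto intro!: I cb2 cb1 C simp: z)
  from 1 2 show ?thesis by simp
qed

lemma integrable_bump_mult:
  assumes "\<rho> > 0" "continuous_on UNIV g"
  shows "integrable lborel (\<lambda>z. bump 3 x \<rho> z * g z)"
  by (rule integrable_continuous_compact_support[where x = x and R = \<rho>])
     (use assms in \<open>auto intro!: continuous_intros simp: bump_eq_0\<close>)

text \<open>Makes uniform closeness sufficient: the tested second derivative is controlled by the
  supremum of f alone, with a constant that serves all functions and all directions.\<close>

lemma integral_bump_partial2_bound:
  fixes x :: "real^'n::finite"
  assumes "\<rho> > 0"
  obtains C where "C > 0" "\<And>f i \<delta>. Ck 2 f \<Longrightarrow> (\<And>z. z \<in> cball x \<rho> \<Longrightarrow> \<bar>f z\<bar> \<le> \<delta>) \<Longrightarrow>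
     \<bar>LINT z|lborel. bump 3 x \<rho> z * partial i (partial i f) z\<bar> \<le> C * \<delta>"
proof
  define K where "K i = (LINT z|lborel. \<bar>bump_deriv2 i x \<rho> z\<bar>)" for i
  have K: "K i \<ge> 0" for i unfolding K_def by simp
  \<comment> \<open>Summing the L^1 norms over all directions makes the constant independent of i;
    the summand 1 makes it positive.\<close>
  show "1 + (\<Sum>i\<in>UNIV. K i) > 0" using K by (simp add: sum_nonneg add_pos_nonneg)
  fix f i \<delta>
  assume f: "Ck 2 f" "\<And>z. z \<in> cball x \<rho> \<Longrightarrow> \<bar>f z\<bar> \<le> \<delta>"
  have cb2: "continuous_on UNIV (bump_deriv2 i x \<rho>)" unfolding bump_deriv2_def by (intro continuous_intros)
  have z: "bump_deriv2 i x \<rho> z = 0" if "z \<notin> cball x \<rho>" for z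
    using that assms by (simp add: bump_deriv2_def bump_eq_0)
  have "\<bar>f x\<bar> \<le> \<delta>" using f assms by simp
  then have d: "\<delta> \<ge> 0" by linarith
  have "\<bar>LINT z|lborel. bump 3 x \<rho> z * partial i (partial i f) z\<bar> = \<bar>LINT z|lborel. bump_deriv2 i x \<rho> z * f z\<bar>"
    using integral_bump_partial2[OF f(1) assms] by simp
  also have "\<dots> \<le> (LINT z|lborel. \<bar>bump_deriv2 i x \<rho> z * f z\<bar>)" by (rule integral_abs_bound)
  also have "\<dots> \<le> (LINT z|lborel. \<bar>bump_deriv2 i x \<rho> z\<bar> * \<delta>)"
  proof (rule integral_mono)
    show "integrable lborel (\<lambda>z. \<bar>bump_deriv2 i x \<rho> z * f z\<bar>)" "integrable lborel (\<lambda>z. \<bar>bump_deriv2 i x \<rho> z\<bar> * \<delta>)"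
      by (rule integrable_continuous_compact_support[where x = x and R = \<rho>];
          use z Ck_2D[OF f(1)] in \<open>auto intro!: continuous_intros cb2\<close>)+
    show "\<bar>bump_deriv2 i x \<rho> z * f z\<bar> \<le> \<bar>bump_deriv2 i x \<rho> z\<bar> * \<delta>" for z
      by (cases "z \<in> cball x \<rho>") (use z f(2) in \<open>auto simp: abs_mult intro!: mult_left_mono\<close>)
  qed
  also have "\<dots> = K i * \<delta>" by (simp add: K_def)
  also have "\<dots> \<le> (1 + (\<Sum>i\<in>UNIV. K i)) * \<delta>"
    using d member_le_sum[of i UNIV K] K by (intro mult_right_mono) auto
  finally show "\<bar>LINT z|lborel. bump 3 x \<rho> z * partial i (partial i f) z\<bar> \<le> (1 + (\<Sum>i\<in>UNIV. K i)) * \<delta>" .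
qed

lemma bump_integral_pos:
  assumes "\<rho> > 0" "continuous_on UNIV g" "\<And>z. z \<in> cball x \<rho> \<Longrightarrow> g z > 0"
  shows "(LINT z|lborel. bump 3 x \<rho> z * g z) > 0"
proof -
  \<comment> \<open>The bump vanishes on the boundary of its ball, so a positive lower bound is
    taken on the ball of half the radius.\<close>
  obtain e where e: "e > 0" "\<And>z. z \<in> cball x (\<rho>/2) \<Longrightarrow> e \<le> bump 3 x \<rho> z * g z"
  proof -
    have "continuous_on (cball x (\<rho>/2)) (\<lambda>z. bump 3 x \<rho> z * g z)"
      by (intro continuous_intros continuous_on_subset[OF assms(2)]) auto
    then obtain w where w: "w \<in> cball x (\<rho>/2)" "\<And>z. z \<in> cball x (\<rho>/2) \<Longrightarrow> bump 3 x \<rho> w * g w \<le> bump 3 x \<rho> z * g z"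
      using continuous_attains_inf[of "cball x (\<rho>/2)" "\<lambda>z. bump 3 x \<rho> z * g z"] assms(1) by auto
    have n: "norm (w - x) < \<rho>" "w \<in> cball x \<rho>" using w(1) assms(1) by (auto simp: dist_norm norm_minus_commute)
    then have "(norm (w - x))\<^sup>2 < \<rho>\<^sup>2" by (intro power_strict_mono) auto
    then have "bump 3 x \<rho> w > 0" by (simp add: bump_def)
    then have "bump 3 x \<rho> w * g w > 0" using assms(3)[OF n(2)] by simp
    with w show ?thesis using that by blast
  qed
  have "0 < measure lborel (cball x (\<rho>/2)) * e" using e(1) assms(1) content_cball_pos[of "\<rho>/2" x] by simp
  also have "\<dots> = (LINT z|lborel. indicator (cball x (\<rho>/2)) z *\<^sub>R e)" by simp
  also have "\<dots> \<le> (LINT z|lborel. bump 3 x \<rho> z * g z)"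
  proof (rule integral_mono)
    show "integrable lborel (\<lambda>z. indicator (cball x (\<rho>/2)) z *\<^sub>R e)" by (rule borel_integrable_compact) auto
    show "integrable lborel (\<lambda>z. bump 3 x \<rho> z * g z)" by (rule integrable_bump_mult[OF assms(1,2)])
    have b0: "bump 3 x \<rho> z \<ge> 0" for z by (simp add: bump_def)
    have "bump 3 x \<rho> z * g z \<ge> 0" for z
      using b0[of z] assms(3)[of z] bump_eq_0[OF assms(1), of 3 z x]
      by (cases "z \<in> cball x \<rho>") (simp_all add: less_imp_le)
    then show "indicator (cball x (\<rho>/2)) z *\<^sub>R e \<le> bump 3 x \<rho> z * g z" for z
      using e(2) by (auto simp: indicator_def)
  qed
  finally show ?thesis .
qed

text \<open>Recovers a pointwise equation from its tested form. A continuous function positive at x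
  is positive on a small ball, against whose bump it has a positive integral; the negative case
  follows by changing the sign.\<close>

lemma bump_integral_zero_imp_zero:
  fixes x :: "real^'n::finite"
  assumes "continuous_on UNIV g" "open S" "x \<in> S"
    and 0: "\<And>\<rho>. \<rho> > 0 \<Longrightarrow> cball x \<rho> \<subseteq> S \<Longrightarrow> (LINT z|lborel. bump 3 x \<rho> z * g z) = 0"
  shows "g x = 0"
proof -
  have main: False if k: "continuous_on UNIV k" "k x > 0"
    and 0: "\<And>\<rho>. \<rho> > 0 \<Longrightarrow> cball x \<rho> \<subseteq> S \<Longrightarrow> (LINT z|lborel. bump 3 x \<rho> z * k z) = 0" for k :: "real^'n \<Rightarrow> real"
  proof -
    have "open (S \<inter> k -` {0<..})"
      using k(1) assms(2) by (intro open_Int open_vimage) auto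
    then obtain \<rho> where "\<rho> > 0" "cball x \<rho> \<subseteq> S \<inter> k -` {0<..}"
      using k(2) assms(3) open_contains_cball by (metis IntI greaterThan_iff vimage_eq)
    then show False using bump_integral_pos[of \<rho> k x] 0[of \<rho>] k(1) by fastforce
  qed
  have "\<not> g x > 0" using main[of g] assms by blast
  moreover have "\<not> - g x > 0" using main[of "\<lambda>z. - g z"] assms by (auto intro!: continuous_intros)
  ultimately show ?thesis by linarith
qed

section \<open>Constant-coefficient operators\<close>

lemma partial_linear:
  assumes "Ck (Suc k) f" "Ck (Suc k) g"
  shows "partial i (\<lambda>z. a * f z + b * g z) = (\<lambda>z. a * partial i f z + b * partial i g z)"
proof
  fix z
  show "partial i (\<lambda>z. a * f z + b * g z) z = a * partial i f z + b * partial i g z"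
    by (rule partialI) (use DERIV_along_axis[OF assms(1), of z i 0] DERIV_along_axis[OF assms(2), of z i 0] in
      \<open>auto intro!: derivative_eq_intros\<close>)
qed

lemma Ck_linear:
  assumes "Ck k f" "Ck k g"
  shows "Ck k (\<lambda>z. a * f z + b * g z)"
  using assms
proof (induction k arbitrary: f g)
  case 0
  then show ?case by (auto intro!: continuous_intros)
next
  case (Suc k)
  have "(\<lambda>t. a * f (z + t *\<^sub>R axis i 1) + b * g (z + t *\<^sub>R axis i 1)) differentiable (at 0)" for i z
    using Suc.prems by (intro derivative_intros) auto
  moreover have "Ck k (partial i (\<lambda>z. a * f z + b * g z))" for i
    unfolding partial_linear[OF Suc.prems] using Suc.prems by (intro Suc.IH) auto
  ultimately show ?case using Suc.prems by (auto intro!: continuous_intros)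
qed

definition Pop :: "('n \<Rightarrow> real) \<Rightarrow> (real^'n::finite \<Rightarrow> real) \<Rightarrow> real^'n \<Rightarrow> real" where
  "Pop \<alpha> f z = (\<Sum>i\<in>UNIV. \<alpha> i * partial i (partial i f) z)"

lemma Pop_linear:
  assumes "Ck 2 f" "Ck 2 g"
  shows "Pop \<alpha> (\<lambda>z. a * f z + b * g z) z = a * Pop \<alpha> f z + b * Pop \<alpha> g z"
  unfolding Pop_def partial_linear[OF Ck_2D(1)[OF assms(1)] Ck_2D(1)[OF assms(2)]]
    partial_linear[OF Ck_2D(2)[OF assms(1)] Ck_2D(2)[OF assms(2)]]
  by (simp add: sum.distrib sum_distrib_left algebra_simps)

lemma continuous_on_Pop: "Ck 2 f \<Longrightarrow> continuous_on UNIV (Pop \<alpha> f)"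
  unfolding Pop_def by (intro continuous_intros Ck_2D)

lemma laplacian_eq_Pop: "laplacian f = Pop (\<lambda>_. 1) f"
  by (simp add: laplacian_def Pop_def fun_eq_iff)

lemma MW_iff: "f \<in> MW \<longleftrightarrow> smooth f \<and> (\<forall>z. Pop (\<lambda>_. 1) f z + f z = 0)"
  by (simp add: MW_def laplacian_eq_Pop)

lemma MW_linear:
  assumes "f \<in> MW" "g \<in> MW"
  shows "(\<lambda>z. a * f z + b * g z) \<in> MW"
proof -
  have "Pop (\<lambda>_. 1) (\<lambda>z. a * f z + b * g z) z = a * Pop (\<lambda>_. 1) f z + b * Pop (\<lambda>_. 1) g z" for z
    by (rule Pop_linear) (use assms in \<open>auto simp: MW_def smooth_def\<close>)
  then have "Pop (\<lambda>_. 1) (\<lambda>z. a * f z + b * g z) z + (a * f z + b * g z)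
      = a * (Pop (\<lambda>_. 1) f z + f z) + b * (Pop (\<lambda>_. 1) g z + g z)" for z
    by (simp add: algebra_simps)
  then show ?thesis using assms unfolding MW_iff smooth_def by (simp add: Ck_linear)
qed

lemma partial_cong_open:
  assumes "open S" "z \<in> S" "\<And>w. w \<in> S \<Longrightarrow> f w = g w"
  shows "partial i f z = partial i g z"
proof -
  have "((\<lambda>t. z + t *\<^sub>R axis i 1) \<longlongrightarrow> z + 0 *\<^sub>R axis i 1) (nhds 0)"
    by (intro tendsto_intros filterlim_ident)
  then have "eventually (\<lambda>t. z + t *\<^sub>R axis i 1 \<in> S) (nhds 0)"
    using assms(1,2) by (auto dest: topological_tendstoD)
  then have "eventually (\<lambda>t. f (z + t *\<^sub>R axis i 1) = g (z + t *\<^sub>R axis i 1)) (nhds 0)"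
    by eventually_elim (use assms(3) in auto)
  then show ?thesis unfolding partial_def by (intro deriv_cong_ev) auto
qed

text \<open>Locality of P. It is needed because a wave outside N gets expressed by the radial wave
  only on the ball, and P is then applied to that expression.\<close>

lemma Pop_cong_open:
  assumes "open S" "z \<in> S" "\<And>w. w \<in> S \<Longrightarrow> f w = g w"
  shows "Pop \<alpha> f z = Pop \<alpha> g z"
  unfolding Pop_def
  by (intro sum.cong refl arg_cong2[where f = "(*)"] partial_cong_open[OF assms(1,2)] partial_cong_open[OF assms(1)] assms(3))

section \<open>The radial wave\<close>

text \<open>\<open>bessel d m\<close> is the m-th derivative of the entire solution J of 4 s J'' + 2 d J' + J = 0
  with J(0) = 1. Up to a constant, J(r^2) is r^(1-d/2) times the Bessel function of order d/2-1,
  the regular radial solution of the Helmholtz equation in dimension d.\<close>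

fun bcoef :: "nat \<Rightarrow> nat \<Rightarrow> real" where
  "bcoef d 0 = 1"
| "bcoef d (Suc n) = - bcoef d n / (real (Suc n) * (4 * real n + 2 * real d))"

definition bessel :: "nat \<Rightarrow> nat \<Rightarrow> real \<Rightarrow> real" where
  "bessel d m s = (\<Sum>n. (diffs ^^ m) (bcoef d) n * s ^ n)"

lemma bcoef_nonzero: "d > 0 \<Longrightarrow> bcoef d n \<noteq> 0"
  by (induction n) (auto simp: add_nonneg_eq_0_iff)

text \<open>The factor \<open>4 * n + 2 * d\<close> is at least 1, so the coefficients are dominated
  by those of the exponential series. All series below therefore converge everywhere.\<close>

lemma abs_bcoef_le: "d > 0 \<Longrightarrow> \<bar>bcoef d n\<bar> \<le> inverse (fact n)"
proof (induction n)
  case (Suc n)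
  have "real (Suc n) * 1 \<le> real (Suc n) * (4 * real n + 2 * real d)"
    using Suc.prems by (intro mult_left_mono) auto
  then have "\<bar>bcoef d (Suc n)\<bar> \<le> inverse (fact n) / real (Suc n)"
    using Suc by (simp add: abs_mult del: mult_1_right of_nat_Suc) (intro frac_le, auto)
  then show ?case by (simp add: field_simps)
qed simp

lemma summable_bessel:
  assumes "d > 0"
  shows "summable (\<lambda>n. (diffs ^^ m) (bcoef d) n * s ^ n)"
proof (induction m arbitrary: s)
  case 0
  have "summable (\<lambda>n. inverse (fact n) * \<bar>s\<bar> ^ n)" by (rule summable_exp)
  then show ?case
    by (rule summable_comparison_test'[where N = 0])
       (auto simp: abs_mult power_abs intro!: mult_right_mono abs_bcoef_le assms)
next
  case (Suc m)
  then show ?case using termdiff_converges_all[of "(diffs ^^ m) (bcoef d)" s] by simp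
qed

lemma DERIV_bessel:
  assumes "d > 0"
  shows "(bessel d m has_real_derivative bessel d (Suc m) s) (at s)"
  unfolding bessel_def
  using termdiffs_strong_converges_everywhere[of "(diffs ^^ m) (bcoef d)" s] summable_bessel[OF assms] by simp

lemma continuous_on_bessel: "d > 0 \<Longrightarrow> continuous_on S (bessel d m)"
  using DERIV_bessel by (metis DERIV_continuous_on has_field_derivative_at_within)

text \<open>The value at 0 is the constant coefficient of the m-fold formal derivative, and
  \<open>diffs\<close> only multiplies nonzero coefficients by positive integers. By continuity the
  derivatives do not vanish at small arguments, which the independence argument uses.\<close>

lemma bessel_at_0_nonzero:
  assumes "d > 0"
  shows "bessel d m 0 \<noteq> 0"
proof -
  have "(diffs ^^ m) (bcoef d) n \<noteq> 0" for n
  proof (induction m arbitrary: n)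
    case 0
    show ?case using bcoef_nonzero[OF assms] by simp
  next
    case (Suc m)
    then show ?case by (simp add: diffs_def del: of_nat_Suc)
  qed
  then show ?thesis by (simp add: bessel_def)
qed

lemma bessel_ODE:
  assumes "d > 0"
  shows "4 * s * bessel d 2 s + 2 * real d * bessel d 1 s + bessel d 0 s = 0"
proof -
  have S: "(\<lambda>n. (diffs ^^ m) (bcoef d) n * s ^ n) sums bessel d m s" for m
    unfolding bessel_def by (rule summable_sums[OF summable_bessel[OF assms]])
  \<comment> \<open>Multiplication by s shifts the index of the second-derivative series by one.
    Since \<open>f 0 = 0\<close>, summation may start at 0, in step with the other two
    series.\<close>
  define f where "f n = real n * real (Suc n) * bcoef d (Suc n) * s ^ n" for n
  have "(\<lambda>n. s * ((diffs ^^ 2) (bcoef d) n * s ^ n)) sums (s * bessel d 2 s)" by (intro sums_mult S)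
  then have "(\<lambda>n. f (Suc n)) sums (s * bessel d 2 s)"
    by (simp add: f_def diffs_def numeral_2_eq_2 mult_ac del: bcoef.simps of_nat_Suc)
  then have "f sums (s * bessel d 2 s)" using sums_Suc[of f] by (simp add: f_def)
  then have "(\<lambda>n. 4 * f n + 2 * real d * ((diffs ^^ 1) (bcoef d) n * s ^ n) + (diffs ^^ 0) (bcoef d) n * s ^ n)
      sums (4 * (s * bessel d 2 s) + 2 * real d * bessel d 1 s + bessel d 0 s)"
    by (intro sums_add sums_mult S)
  \<comment> \<open>The coefficient of s^n is \<open>bcoef d (Suc n)\<close> times (n+1)(4n+2d),
    plus \<open>bcoef d n\<close>; the recursion for \<open>bcoef\<close> is its vanishing.\<close>
  moreover have "4 * f n + 2 * real d * ((diffs ^^ 1) (bcoef d) n * s ^ n) + (diffs ^^ 0) (bcoef d) n * s ^ n = 0" for n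
  proof -
    define X where "X = real (Suc n) * (4 * real n + 2 * real d)"
    have "X \<noteq> 0" using assms by (simp add: X_def add_nonneg_eq_0_iff)
    moreover have "bcoef d (Suc n) = - bcoef d n / X" unfolding X_def by (rule bcoef.simps(2))
    ultimately have "(bcoef d (Suc n) * X + bcoef d n) * s ^ n = 0" by (simp del: bcoef.simps)
    then have "(bcoef d (Suc n) * (real (Suc n) * (4 * real n + 2 * real d)) + bcoef d n) * s ^ n = 0"
      unfolding X_def .
    then show ?thesis by (simp add: f_def diffs_def algebra_simps del: bcoef.simps)
  qed
  ultimately have "(\<lambda>n. 0) sums (4 * (s * bessel d 2 s) + 2 * real d * bessel d 1 s + bessel d 0 s)" by simp
  from sums_unique2[OF this sums_zero] show ?thesis by (simp add: mult.assoc)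
qed

text \<open>The profile is composed with the squared distance, which is smooth also at c. The index
  m counts derivatives of the profile, so that partial derivatives stay among coordinate multiples
  of this family.\<close>

definition radial :: "real^'n::finite \<Rightarrow> nat \<Rightarrow> real^'n \<Rightarrow> real" where
  "radial c m z = bessel CARD('n) m ((norm (z - c))\<^sup>2)"

lemma DERIV_radial:
  "((\<lambda>t. radial c m (z + t *\<^sub>R axis i 1)) has_real_derivative
     2 * ((z + t *\<^sub>R axis i 1 - c) $ i) * radial c (Suc m) (z + t *\<^sub>R axis i 1)) (at t)"
  unfolding radial_def
  by (rule DERIV_cong[OF DERIV_chain2[OF DERIV_bessel DERIV_norm_sq_axis]]) auto

lemma continuous_on_radial: "continuous_on S (radial c m)"
  unfolding radial_def
  by (rule continuous_on_compose2[OF continuous_on_bessel[of _ UNIV]]) (auto intro!: continuous_intros)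

text \<open>An algebra containing the radial waves and closed under partial derivatives, so that its
  elements are smooth.\<close>

inductive radial_alg :: "real^'n::finite \<Rightarrow> (real^'n \<Rightarrow> real) \<Rightarrow> bool" for c where
  radial: "radial_alg c (radial c m)"
| const: "radial_alg c (\<lambda>z. a)"
| coord: "radial_alg c (\<lambda>z. (z - c) $ i)"
| add: "radial_alg c f \<Longrightarrow> radial_alg c g \<Longrightarrow> radial_alg c (\<lambda>z. f z + g z)"
| mult: "radial_alg c f \<Longrightarrow> radial_alg c g \<Longrightarrow> radial_alg c (\<lambda>z. f z * g z)"

lemma radial_alg_continuous: "radial_alg c f \<Longrightarrow> continuous_on UNIV f"
  by (induction rule: radial_alg.induct) (auto intro!: continuous_intros continuous_on_radial)

lemma radial_alg_derivative:
  "radial_alg c f \<Longrightarrow> \<exists>g. radial_alg c g \<and>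
     (\<forall>z t. ((\<lambda>t. f (z + t *\<^sub>R axis i 1)) has_real_derivative g (z + t *\<^sub>R axis i 1)) (at t))"
proof (induction rule: radial_alg.induct)
  case (radial m)
  show ?case
    using DERIV_radial by (intro exI[of _ "\<lambda>z. 2 * ((z - c) $ i) * radial c (Suc m) z"])
      (auto intro!: radial_alg.intros simp del: vector_minus_component)
next
  case (const a)
  show ?case by (intro exI[of _ "\<lambda>z. 0"]) (auto intro: radial_alg.intros)
next
  case (coord j)
  show ?case by (intro exI[of _ "\<lambda>z. axis i 1 $ j"]) (auto intro!: radial_alg.intros derivative_eq_intros)
next
  case (add f g)
  then obtain f' g' where "radial_alg c f'" "radial_alg c g'"
    "\<And>z t. ((\<lambda>t. f (z + t *\<^sub>R axis i 1)) has_real_derivative f' (z + t *\<^sub>R axis i 1)) (at t)"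
    "\<And>z t. ((\<lambda>t. g (z + t *\<^sub>R axis i 1)) has_real_derivative g' (z + t *\<^sub>R axis i 1)) (at t)" by blast
  then show ?case by (intro exI[of _ "\<lambda>z. f' z + g' z"]) (auto intro!: radial_alg.intros DERIV_add)
next
  case (mult f g)
  then obtain f' g' where "radial_alg c f'" "radial_alg c g'"
    "\<And>z t. ((\<lambda>t. f (z + t *\<^sub>R axis i 1)) has_real_derivative f' (z + t *\<^sub>R axis i 1)) (at t)"
    "\<And>z t. ((\<lambda>t. g (z + t *\<^sub>R axis i 1)) has_real_derivative g' (z + t *\<^sub>R axis i 1)) (at t)" by blast
  with mult.hyps show ?case by (intro exI[of _ "\<lambda>z. f' z * g z + g' z * f z"]) (auto intro!: radial_alg.intros DERIV_mult)
qed

lemma radial_alg_Ck: "radial_alg c f \<Longrightarrow> Ck k f"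
proof (induction k arbitrary: f)
  case 0
  then show ?case by (simp add: radial_alg_continuous)
next
  case (Suc k)
  have "(\<lambda>t. f (z + t *\<^sub>R axis i 1)) differentiable (at 0)" for i z
    using radial_alg_derivative[OF Suc.prems] real_differentiable_def by blast
  moreover have "Ck k (partial i f)" for i
  proof -
    obtain g where g: "radial_alg c g"
      "\<And>z t. ((\<lambda>t. f (z + t *\<^sub>R axis i 1)) has_real_derivative g (z + t *\<^sub>R axis i 1)) (at t)"
      using radial_alg_derivative[OF Suc.prems] by blast
    have "partial i f = g" using g(2)[of _ 0] by (intro ext partialI) simp
    then show ?thesis using g Suc.IH by simp
  qed
  ultimately show ?case using Suc.prems by (simp add: radial_alg_continuous)
qed

lemma partial_radial: "partial i (radial c m) = (\<lambda>z. 2 * ((z - c) $ i) * radial c (Suc m) z)"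
  by (intro ext partialI) (use DERIV_radial[of c m _ i 0] in simp)

lemma partial2_radial:
  "partial i (partial i (radial c m)) = (\<lambda>z. 2 * radial c (m + 1) z + 4 * ((z - c) $ i)\<^sup>2 * radial c (m + 2) z)"
  unfolding partial_radial
proof (intro ext partialI)
  fix z
  have "((\<lambda>t. 2 * ((z + t *\<^sub>R axis i 1 - c) $ i)) has_real_derivative 2) (at 0)"
    by (auto intro!: derivative_eq_intros)
  from DERIV_mult[OF this DERIV_radial]
  show "((\<lambda>t. 2 * ((z + t *\<^sub>R axis i 1 - c) $ i) * radial c (Suc m) (z + t *\<^sub>R axis i 1)) has_real_derivative
      2 * radial c (m + 1) z + 4 * ((z - c) $ i)\<^sup>2 * radial c (m + 2) z) (at 0)"
    by (rule DERIV_cong) (simp add: power2_eq_square algebra_simps)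
qed

section \<open>Action of P and P^2 on radial waves\<close>

definition qform :: "('n \<Rightarrow> real) \<Rightarrow> real^'n::finite \<Rightarrow> real^'n \<Rightarrow> real" where
  "qform \<alpha> c z = (\<Sum>i\<in>UNIV. \<alpha> i * ((z - c) $ i)\<^sup>2)"

lemma Pop_radial:
  "Pop \<alpha> (radial c m) z = 2 * sum \<alpha> UNIV * radial c (m + 1) z + 4 * qform \<alpha> c z * radial c (m + 2) z"
  unfolding Pop_def partial2_radial qform_def
  by (simp add: sum.distrib sum_distrib_left sum_distrib_right algebra_simps)

lemma qform_alg: "radial_alg c (qform \<alpha> c)"
proof -
  have "radial_alg c (\<lambda>z. \<Sum>i\<in>S. \<alpha> i * ((z - c) $ i)\<^sup>2)" if "finite S" for S
    using that by (induction S) (auto intro!: radial_alg.intros simp: power2_eq_square simp del: vector_minus_component)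
  then show ?thesis unfolding qform_def[abs_def] by simp
qed

lemma DERIV_qform:
  "((\<lambda>t. qform \<alpha> c (z + t *\<^sub>R axis i 1)) has_real_derivative 2 * \<alpha> i * ((z + t *\<^sub>R axis i 1 - c) $ i)) (at t)"
proof -
  have "((\<lambda>t. qform \<alpha> c (z + t *\<^sub>R axis i 1)) has_real_derivative
     (\<Sum>j\<in>UNIV. \<alpha> j * (2 * ((z + t *\<^sub>R axis i 1 - c) $ j) * (axis i 1 $ j)))) (at t)"
    unfolding qform_def by (auto intro!: derivative_eq_intros sum.cong)
  also have "(\<Sum>j\<in>UNIV. \<alpha> j * (2 * ((z + t *\<^sub>R axis i 1 - c) $ j) * (axis i 1 $ j)))
      = 2 * \<alpha> i * ((z + t *\<^sub>R axis i 1 - c) $ i)"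
    by (subst sum.remove[of _ i]) (auto simp: axis_def intro!: sum.neutral)
  finally show ?thesis by (simp add: mult.assoc)
qed

text \<open>Product rule for P: the term P(q) gives the sum of the squared weights, and the mixed
  first derivatives give the form with squared weights.\<close>

lemma Pop_qform_radial:
  "Pop \<alpha> (\<lambda>z. qform \<alpha> c z * radial c m z) z =
     2 * (\<Sum>i\<in>UNIV. (\<alpha> i)\<^sup>2) * radial c m z
     + (8 * qform (\<lambda>i. (\<alpha> i)\<^sup>2) c z + 2 * sum \<alpha> UNIV * qform \<alpha> c z) * radial c (m + 1) z
     + 4 * (qform \<alpha> c z)\<^sup>2 * radial c (m + 2) z"
proof -
  have 1: "partial i (\<lambda>z. qform \<alpha> c z * radial c m z) =
     (\<lambda>z. 2 * \<alpha> i * ((z - c) $ i) * radial c m z + qform \<alpha> c z * (2 * ((z - c) $ i) * radial c (m + 1) z))" for i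
  proof (intro ext partialI)
    fix z
    show "((\<lambda>t. qform \<alpha> c (z + t *\<^sub>R axis i 1) * radial c m (z + t *\<^sub>R axis i 1)) has_real_derivative
       2 * \<alpha> i * ((z - c) $ i) * radial c m z + qform \<alpha> c z * (2 * ((z - c) $ i) * radial c (m + 1) z)) (at 0)"
      by (rule DERIV_cong[OF DERIV_mult[OF DERIV_qform DERIV_radial]]) simp
  qed
  have 2: "partial i (partial i (\<lambda>z. qform \<alpha> c z * radial c m z)) =
     (\<lambda>z. 2 * \<alpha> i * radial c m z + 8 * (\<alpha> i * ((z - c) $ i)\<^sup>2) * radial c (m + 1) z
        + 2 * qform \<alpha> c z * radial c (m + 1) z + 4 * qform \<alpha> c z * ((z - c) $ i)\<^sup>2 * radial c (m + 2) z)" for i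
    unfolding 1
  proof (intro ext partialI)
    fix z
    have L: "((\<lambda>t. a * ((z + t *\<^sub>R axis i 1 - c) $ i)) has_real_derivative a) (at 0)" for a
      by (auto intro!: derivative_eq_intros)
    show "((\<lambda>t. 2 * \<alpha> i * ((z + t *\<^sub>R axis i 1 - c) $ i) * radial c m (z + t *\<^sub>R axis i 1)
         + qform \<alpha> c (z + t *\<^sub>R axis i 1) * (2 * ((z + t *\<^sub>R axis i 1 - c) $ i) * radial c (m + 1) (z + t *\<^sub>R axis i 1)))
       has_real_derivative 2 * \<alpha> i * radial c m z + 8 * (\<alpha> i * ((z - c) $ i)\<^sup>2) * radial c (m + 1) z
        + 2 * qform \<alpha> c z * radial c (m + 1) z + 4 * qform \<alpha> c z * ((z - c) $ i)\<^sup>2 * radial c (m + 2) z) (at 0)"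
      by (rule DERIV_cong[OF DERIV_add[OF DERIV_mult[OF L DERIV_radial]
            DERIV_mult[OF DERIV_qform DERIV_mult[OF L DERIV_radial]]]])
         (simp add: power2_eq_square algebra_simps)
  qed
  have S1: "(\<Sum>i\<in>UNIV. \<alpha> i * (4 * Q * ((z - c) $ i)\<^sup>2 * R)) = 4 * Q * R * qform \<alpha> c z" for Q R
    by (simp add: qform_def sum_distrib_left algebra_simps)
  have S2: "(\<Sum>i\<in>UNIV. \<alpha> i * (8 * (\<alpha> i * ((z - c) $ i)\<^sup>2) * R)) = 8 * qform (\<lambda>i. (\<alpha> i)\<^sup>2) c z * R" for R
    by (simp add: qform_def sum_distrib_left sum_distrib_right power2_eq_square algebra_simps)
  have S3: "(\<Sum>i\<in>UNIV. \<alpha> i * (2 * \<alpha> i * R)) = 2 * (\<Sum>i\<in>UNIV. (\<alpha> i)\<^sup>2) * R" for R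
    by (simp add: sum_distrib_left sum_distrib_right power2_eq_square algebra_simps)
  have S4: "(\<Sum>i\<in>UNIV. \<alpha> i * (2 * Q * R)) = 2 * sum \<alpha> UNIV * Q * R" for Q R
    by (simp add: sum_distrib_left sum_distrib_right algebra_simps)
  show ?thesis unfolding Pop_def 2 distrib_left sum.distrib S1 S2 S3 S4
    by (simp add: power2_eq_square[of "qform _ _ _"] algebra_simps)
qed

lemma radial_Ck: "Ck k (radial c m)"
  by (rule radial_alg_Ck[OF radial_alg.radial])

lemma Pop2_radial:
  "Pop \<alpha> (Pop \<alpha> (radial c 0)) z =
     (4 * (sum \<alpha> UNIV)\<^sup>2 + 8 * (\<Sum>i\<in>UNIV. (\<alpha> i)\<^sup>2)) * radial c 2 z
     + (16 * sum \<alpha> UNIV * qform \<alpha> c z + 32 * qform (\<lambda>i. (\<alpha> i)\<^sup>2) c z) * radial c 3 z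
     + 16 * (qform \<alpha> c z)\<^sup>2 * radial c 4 z"
proof -
  have "Pop \<alpha> (radial c 0) = (\<lambda>z. 2 * sum \<alpha> UNIV * radial c 1 z + 4 * (qform \<alpha> c z * radial c 2 z))"
    by (rule ext) (simp add: Pop_radial numeral_2_eq_2)
  moreover have "Ck 2 (\<lambda>z. qform \<alpha> c z * radial c 2 z)"
    by (intro radial_alg_Ck[of c] radial_alg.intros qform_alg)
  ultimately have "Pop \<alpha> (Pop \<alpha> (radial c 0)) z = 2 * sum \<alpha> UNIV * Pop \<alpha> (radial c 1) z + 4 * Pop \<alpha> (\<lambda>z. qform \<alpha> c z * radial c 2 z) z"
    by (simp only: Pop_linear[OF radial_Ck])
  then show ?thesis
    by (simp add: Pop_radial Pop_qform_radial power2_eq_square[of "sum \<alpha> UNIV"] algebra_simps numeral_eq_Suc)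
qed

lemma Pop_radial_Ck: "Ck k (Pop \<alpha> (radial c 0))"
proof -
  have "Pop \<alpha> (radial c 0) = (\<lambda>z. 2 * sum \<alpha> UNIV * radial c 1 z + 4 * qform \<alpha> c z * radial c 2 z)"
    by (rule ext) (simp add: Pop_radial numeral_2_eq_2)
  then show ?thesis by (auto intro!: radial_alg_Ck[of c] radial_alg.intros qform_alg)
qed

lemma qform_one: "qform (\<lambda>_. 1) c z = (norm (z - c))\<^sup>2"
  unfolding qform_def power2_norm_eq_inner inner_vec_def by (simp add: power2_eq_square)

text \<open>With unit weights the sum of the weights is the dimension and the quadratic form is the
  squared distance, so the formula for \<open>Pop\<close> becomes the left side of
  \<open>bessel_ODE\<close>.\<close>

lemma radial_MW: "radial c 0 \<in> MW"
  unfolding MW_iff smooth_def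
proof (intro conjI allI radial_Ck)
  fix z :: "real^'a"
  show "Pop (\<lambda>_. 1) (radial c 0) z + radial c 0 z = 0"
    using bessel_ODE[of "CARD('a)" "(norm (z - c))\<^sup>2"]
    unfolding Pop_radial qform_one by (simp add: radial_def numeral_2_eq_2)
qed

text \<open>On a sphere about c all profile derivatives are constants. Moving on it within the plane
  of directions j and k, with the squared k-th coordinate \<tau> as parameter, the three functions
  become polynomials in \<tau> of degrees 2, 1 and 0.\<close>

lemma radial_Pop_independent:
  fixes c :: "real^'n::finite"
  assumes jk: "j \<noteq> k" and \<alpha>: "\<alpha> k = 1" "\<alpha> j = 0" and r: "r > 0"
    and eq: "\<And>z. z \<in> ball c r \<Longrightarrow> u * Pop \<alpha> (Pop \<alpha> (radial c 0)) z + v * Pop \<alpha> (radial c 0) z + w * radial c 0 z = 0"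
  shows "u = 0" "v = 0"
proof -
  let ?J = "bessel CARD('n)"
  have "eventually (\<lambda>s. ?J m s \<noteq> 0) (at_right 0)" for m
  proof -
    have "(?J m \<longlongrightarrow> ?J m 0) (at_right 0)"
      using DERIV_isCont[OF DERIV_bessel[of "CARD('n)" m 0]] by (simp add: isCont_def filterlim_at_split)
    then show ?thesis using bessel_at_0_nonzero[of "CARD('n)" m] by (auto intro: tendsto_imp_eventually_ne)
  qed
  \<comment> \<open>\<open>?J 4 s\<close> occurs in the leading coefficient of P^2 of the radial
    wave and \<open>?J 2 s\<close> in that of P. Both must be nonzero on the chosen sphere, which
    must lie inside the ball.\<close>
  then have "eventually (\<lambda>s. ?J 4 s \<noteq> 0 \<and> ?J 2 s \<noteq> 0 \<and> s \<in> {0<..<r\<^sup>2}) (at_right 0)"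
    using r by (intro eventually_conj eventually_at_right_real) auto
  then obtain s where s: "?J 4 s \<noteq> 0" "?J 2 s \<noteq> 0" "0 < s" "s < r\<^sup>2"
    using eventually_happens[of _ "at_right (0::real)"] by auto
  define A where "A = sum \<alpha> UNIV"
  define B where "B = (\<Sum>i\<in>UNIV. (\<alpha> i)\<^sup>2)"
  have *: "u * ((4 * A\<^sup>2 + 8 * B) * ?J 2 s + (16 * A * \<tau> + 32 * \<tau>) * ?J 3 s + 16 * \<tau>\<^sup>2 * ?J 4 s)
      + v * (2 * A * ?J 1 s + 4 * \<tau> * ?J 2 s) + w * ?J 0 s = 0" if \<tau>: "0 \<le> \<tau>" "\<tau> \<le> s" for \<tau>
  proof -
    define y :: "real^'n" where "y = sqrt \<tau> *\<^sub>R axis k 1 + sqrt (s - \<tau>) *\<^sub>R axis j 1"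
    have y: "(y $ i)\<^sup>2 = (if i = k then \<tau> else if i = j then s - \<tau> else 0)" for i
      using \<tau> jk by (auto simp: y_def axis_def)
    \<comment> \<open>The weights at k and j are 1 and 0, which squaring does not change. Hence the
      forms with weights \<alpha> and \<alpha>^2 both equal \<tau> at this point.\<close>
    have q: "qform \<beta> c (c + y) = \<beta> k * \<tau> + \<beta> j * (s - \<tau>)" for \<beta>
    proof -
      have "qform \<beta> c (c + y) = (\<Sum>i\<in>UNIV. (if i = k then \<beta> k * \<tau> else 0) + (if i = j then \<beta> j * (s - \<tau>) else 0))"
        unfolding qform_def using jk by (intro sum.cong) (auto simp: y)
      then show ?thesis by (simp add: sum.distrib)
    qed
    have n: "(norm y)\<^sup>2 = s" using q[of "\<lambda>_. 1"] by (simp add: qform_one)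
    have "(norm y)\<^sup>2 < r\<^sup>2" using s n by simp
    then have "norm y < r" using r power2_less_imp_less by fastforce
    then have "c + y \<in> ball c r" by (simp add: dist_norm)
    have J2: "?J (Suc (Suc 0)) = ?J 2" by (simp add: numeral_2_eq_2)
    from eq[OF \<open>c + y \<in> ball c r\<close>] show ?thesis
      unfolding Pop2_radial Pop_radial q by (simp add: \<alpha> radial_def n A_def B_def J2)
  qed
  have e0: "u * ((4 * A\<^sup>2 + 8 * B) * ?J 2 s) + v * (2 * A * ?J 1 s) + w * ?J 0 s = 0"
    using *[of 0] s by simp
  define L X where "L = u * (16 * A + 32) * ?J 3 s + 4 * v * ?J 2 s" and "X = 16 * u * ?J 4 s"
  \<comment> \<open>Subtracting the relation at \<tau> = 0 removes all constant terms, including the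
    one with w. Division by \<tau> leaves an affine function, which is then evaluated at s and
    s/2.\<close>
  have q: "L + \<tau> * X = 0" if "0 < \<tau>" "\<tau> \<le> s" for \<tau>
  proof -
    have "\<tau> * (L + \<tau> * X) = 0"
      using *[of \<tau>] e0 that unfolding L_def X_def power2_eq_square by (simp only: less_imp_le) algebra
    then show ?thesis using that by simp
  qed
  have "L + s * X = 0" "L + (s / 2) * X = 0" using q[of s] q[of "s/2"] s by auto
  moreover have "s / 2 * X = s * X / 2" by simp
  ultimately have "s * X = 0" and e1: "L + s * X = 0" by linarith+
  then show "u = 0" using s by (simp add: X_def)
  then have "4 * v * ?J 2 s = 0" using e1 by (simp add: L_def X_def)
  then show "v = 0" using s by simp
qed

text \<open>With F(x) = J(x^2) and p = (d-1)/2, the function G = x^p F solves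
  G'' = (K/x^2 - 1) G for K = p(p-1), so the energy G^2 + G'^2 grows by a factor at most
  exp(|K|) on [1, \<infinity>).\<close>

lemma radial_decay_line:
  assumes d: "d > 0"
  obtains C where "\<And>\<rho>. \<rho> \<ge> 1 \<Longrightarrow> \<rho> powr ((real d - 1) / 2) * \<bar>bessel d 0 (\<rho>\<^sup>2)\<bar> \<le> C"
proof
  define p where "p = (real d - 1) / 2"
  define K where "K = p * (p - 1)"
  define F where "F x = bessel d 0 (x\<^sup>2)" for x
  define F' where "F' x = 2 * x * bessel d 1 (x\<^sup>2)" for x
  define G where "G x = x powr p * F x" for x
  define G' where "G' x = x powr p * (F' x + p * F x / x)" for x
  \<comment> \<open>The energy has logarithmic derivative at most |K|/x^2, and the exponential
    factor has logarithmic derivative -|K|/x^2. Their product is therefore nonincreasing, and it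
    dominates the energy.\<close>
  define W where "W x = ((G x)\<^sup>2 + (G' x)\<^sup>2) * exp (\<bar>K\<bar> / x)" for x
  have dF: "(F has_real_derivative F' x) (at x)" for x
    unfolding F_def F'_def
    by (rule DERIV_cong[OF DERIV_chain2[OF DERIV_bessel[OF d]]]) (auto intro!: derivative_eq_intros)
  have dF': "(F' has_real_derivative - F x - 2 * p * F' x / x) (at x)" if "x > 0" for x
  proof -
    have "(F' has_real_derivative 2 * bessel d 1 (x\<^sup>2) + 4 * x\<^sup>2 * bessel d 2 (x\<^sup>2)) (at x)"
      unfolding F'_def
      by (rule DERIV_cong[OF DERIV_mult[OF _ DERIV_chain2[OF DERIV_bessel[OF d]]]])
         (auto intro!: derivative_eq_intros simp: power2_eq_square numeral_2_eq_2)
    moreover have pd: "real d = 2 * p + 1" by (simp add: p_def field_simps)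
    have "2 * bessel d 1 (x\<^sup>2) + 4 * x\<^sup>2 * bessel d 2 (x\<^sup>2) = - F x - 2 * p * F' x / x"
      using bessel_ODE[OF d, of "x\<^sup>2"] that unfolding pd by (simp add: F_def F'_def algebra_simps)
    ultimately show ?thesis by simp
  qed
  have dpow: "((\<lambda>x. x powr p) has_real_derivative x powr p * p / x) (at x)" if "x > 0" for x
    using that by (auto intro!: derivative_eq_intros simp: powr_diff)
  have dG: "(G has_real_derivative G' x) (at x)" if "x > 0" for x
    unfolding G_def
    by (rule DERIV_cong[OF DERIV_mult[OF dpow[OF that] dF]]) (simp add: G'_def algebra_simps)
  have dG': "(G' has_real_derivative (K / x\<^sup>2 - 1) * G x) (at x)" if "x > 0" for x
  proof -
    have "X * p / x * (f' + p * f / x) + (- f - 2 * p * f' / x + (p * f' * x - p * f) / (x * x)) * X = (K / x\<^sup>2 - 1) * (X * f)"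
      for X f f'
      using that by (simp add: K_def field_simps power2_eq_square)
    then show ?thesis
      using DERIV_mult[OF dpow[OF that] DERIV_add[OF dF'[OF that] DERIV_divide[OF DERIV_cmult[OF dF] DERIV_ident]], of p] that
      unfolding G_def G'_def[abs_def] by simp
  qed
  have dE: "((\<lambda>x. (G x)\<^sup>2 + (G' x)\<^sup>2) has_real_derivative 2 * (G x * G' x) * K / x\<^sup>2) (at x)" if "x > 0" for x
    by (rule DERIV_cong[OF DERIV_add[OF DERIV_power[OF dG[OF that]] DERIV_power[OF dG'[OF that]]]])
       (simp add: algebra_simps)
  have dX: "((\<lambda>x. exp (\<bar>K\<bar> / x)) has_real_derivative exp (\<bar>K\<bar> / x) * (- \<bar>K\<bar> / x\<^sup>2)) (at x)" if "x > 0" for x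
    using that by (auto intro!: derivative_eq_intros simp: power2_eq_square)
  have dW: "(W has_real_derivative (2 * (G x * G' x) * K - ((G x)\<^sup>2 + (G' x)\<^sup>2) * \<bar>K\<bar>) / x\<^sup>2 * exp (\<bar>K\<bar> / x)) (at x)"
    if "x > 0" for x
    unfolding W_def
    by (rule DERIV_cong[OF DERIV_mult[OF dE[OF that] dX[OF that]]]) (simp add: diff_divide_distrib algebra_simps)
  have neg: "(2 * (G x * G' x) * K - ((G x)\<^sup>2 + (G' x)\<^sup>2) * \<bar>K\<bar>) / x\<^sup>2 * exp (\<bar>K\<bar> / x) \<le> 0" if "x > 0" for x
  proof -
    have "2 * (G x * G' x) * K \<le> \<bar>2 * (G x * G' x)\<bar> * \<bar>K\<bar>" by (simp flip: abs_mult)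
    also have "\<bar>2 * (G x * G' x)\<bar> \<le> (G x)\<^sup>2 + (G' x)\<^sup>2"
      using sum_squares_bound[of "\<bar>G x\<bar>" "\<bar>G' x\<bar>"] by (simp add: abs_mult)
    finally show ?thesis by (simp add: divide_nonpos_nonneg mult_nonpos_nonneg mult_right_mono)
  qed
  show "\<rho> powr ((real d - 1) / 2) * \<bar>bessel d 0 (\<rho>\<^sup>2)\<bar> \<le> sqrt (W 1)" if "\<rho> \<ge> 1" for \<rho>
  proof -
    have "W \<rho> \<le> W 1"
    proof (rule DERIV_nonpos_imp_nonincreasing[OF that])
      fix x :: real
      assume "1 \<le> x"
      then show "\<exists>y. (W has_real_derivative y) (at x) \<and> y \<le> 0"
        using dW[of x] neg[of x] by (intro exI conjI) auto
    qed
    moreover have "(G \<rho>)\<^sup>2 * 1 \<le> W \<rho>"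
      unfolding W_def using that by (intro mult_mono) auto
    ultimately have "\<bar>G \<rho>\<bar> \<le> sqrt (W 1)" by (intro real_le_rsqrt) auto
    then show ?thesis by (simp add: G_def F_def p_def abs_mult)
  qed
qed

lemma radial_MWs: "radial c 0 \<in> MWs"
proof -
  let ?p = "(real CARD('a) - 1) / 2"
  let ?w = "\<lambda>z::real^'a. (1 + norm z) powr ?p"
  have p: "?p \<ge> 0" by (simp add: Suc_leI)
  obtain C where C: "\<And>\<rho>. \<rho> \<ge> 1 \<Longrightarrow> \<rho> powr ?p * \<bar>bessel CARD('a) 0 (\<rho>\<^sup>2)\<bar> \<le> C"
    using radial_decay_line[OF zero_less_card_finite[where 'a = 'a]] by blast
  have "continuous_on (cball c 1) (\<lambda>z. ?w z * radial c 0 z)"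
    by (intro continuous_intros continuous_on_radial) (simp add: add_nonneg_eq_0_iff)
  then have "bounded ((\<lambda>z. ?w z * radial c 0 z) ` cball c 1)"
    by (intro compact_imp_bounded compact_continuous_image) auto
  then obtain D where D0: "\<forall>y\<in>(\<lambda>z. ?w z * radial c 0 z) ` cball c 1. norm y \<le> D"
    unfolding bounded_iff by blast
  have D: "\<bar>?w z * radial c 0 z\<bar> \<le> D" if "z \<in> cball c 1" for z
    using bspec[OF D0 imageI[OF that]] by (simp only: real_norm_def)
  have "?w z * \<bar>radial c 0 z\<bar> \<le> max D ((2 + norm c) powr ?p * C)" for z
  proof (cases "z \<in> cball c 1")
    case True
    then show ?thesis using D[of z] by (simp add: abs_mult)
  next
    case False
    then have n: "norm (z - c) \<ge> 1" by (simp add: dist_norm norm_minus_commute)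
    \<comment> \<open>The weight is centred at 0 and the decay at c; outside the unit ball about c
      the two distances are comparable. Inside that ball, compactness gave the bound.\<close>
    have "1 + norm z \<le> 1 + (norm c + norm (z - c))" using norm_triangle_sub[of z c] by simp
    also have "\<dots> \<le> (2 + norm c) * norm (z - c)"
      using mult_right_mono[OF n, of "1 + norm c"] n by (simp add: algebra_simps)
    finally have "?w z \<le> ((2 + norm c) * norm (z - c)) powr ?p" using p by (intro powr_mono2) auto
    also have "\<dots> = (2 + norm c) powr ?p * norm (z - c) powr ?p" by (simp add: powr_mult)
    finally have "?w z * \<bar>radial c 0 z\<bar> \<le> (2 + norm c) powr ?p * norm (z - c) powr ?p * \<bar>radial c 0 z\<bar>"
      by (intro mult_right_mono) auto
    also have "\<dots> \<le> (2 + norm c) powr ?p * C"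
      using mult_left_mono[OF C[OF n], of "(2 + norm c) powr ?p"] by (simp add: radial_def mult.assoc)
    finally show ?thesis by simp
  qed
  then have "\<exists>C. \<forall>z. ?w z * \<bar>radial c 0 z\<bar> \<le> C" by (intro exI allI)
  then show ?thesis using radial_MW[of c] by (simp add: MWs_def)
qed

section \<open>Rescaled eigenfunctions\<close>

text \<open>Over the rationals, an irrational s and 1 are linearly independent, so prescribed values
  on them extend to a linear map of the reals. Such a T is never continuous.\<close>

lemma rational_functional:
  fixes s :: real
  assumes "s \<notin> \<rat>"
  obtains T :: "real \<Rightarrow> real" where "T 1 = 1" "T s = 0"
    "\<And>x y. T (x + y) = T x + T y" "\<And>q x. T (of_rat q * x) = of_rat q * T x"
proof -
  interpret V: vector_space "\<lambda>(q::rat) (x::real). of_rat q * x"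
    by unfold_locales (auto simp: of_rat_add of_rat_mult algebra_simps)
  interpret VP: vector_space_pair "\<lambda>(q::rat) (x::real). of_rat q * x" "\<lambda>(q::rat) (x::real). of_rat q * x"
    by unfold_locales
  have ns: "s \<notin> V.span {1}"
    using assms by (auto simp: V.span_breakdown_eq Rats_def)
  have "V.independent {s, 1}"
    using ns by (simp add: V.independent_insert)
  then obtain T where T: "Vector_Spaces.linear (\<lambda>(q::rat) (x::real). of_rat q * x) (\<lambda>(q::rat) (x::real). of_rat q * x) T" "\<forall>x\<in>{s,1}. T x = (if x = 1 then 1 else 0)"
    using VP.linear_independent_extend[of "{s,1}" "\<lambda>x. if x = 1 then 1 else 0"] by blast
  interpret TL: Vector_Spaces.linear "\<lambda>(q::rat) (x::real). of_rat q * x" "\<lambda>(q::rat) (x::real). of_rat q * x" T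
    by (rule T(1))
  have "s \<noteq> 1" using assms by auto
  then show ?thesis using that T(2) TL.add TL.scale by auto
qed

lemma sin_add_pi_half: "sin (w + pi / 2) = cos w" for w :: real
  by (simp add: sin_add)

text \<open>Cosines are sines with shifted phases, so both boundary conditions and all derivatives are
  covered by the same family.\<close>

definition sin_prod :: "('n \<Rightarrow> real) \<Rightarrow> ('n \<Rightarrow> real) \<Rightarrow> real^'n::finite \<Rightarrow> real" where
  "sin_prod \<omega> \<theta> x = (\<Prod>j\<in>UNIV. sin (\<omega> j * x $ j + \<theta> j))"

lemma continuous_on_sin_prod: "continuous_on S (sin_prod \<omega> \<theta>)"
  unfolding sin_prod_def by (intro continuous_intros)

lemma DERIV_sin_prod:
  "((\<lambda>t. sin_prod \<omega> \<theta> (z + t *\<^sub>R axis i 1)) has_real_derivative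
     \<omega> i * sin_prod \<omega> (\<theta>(i := \<theta> i + pi / 2)) (z + t *\<^sub>R axis i 1)) (at t)"
proof -
  define Q where "Q = (\<Prod>j\<in>UNIV - {i}. sin (\<omega> j * z $ j + \<theta> j))"
  have Q: "(\<Prod>j\<in>UNIV - {i}. sin (\<omega> j * (z + t *\<^sub>R axis i 1) $ j + \<theta> j)) = Q" for t
    unfolding Q_def by (intro prod.cong) (auto simp: axis_def)
  have Q': "(\<Prod>j\<in>UNIV - {i}. sin (\<omega> j * (z + t *\<^sub>R axis i 1) $ j + (\<theta>(i := \<theta> i + pi / 2)) j)) = Q" for t
    unfolding Q_def by (intro prod.cong) (auto simp: axis_def)
  have 1: "sin_prod \<omega> \<theta> (z + t *\<^sub>R axis i 1) = sin (\<omega> i * (z $ i + t) + \<theta> i) * Q" for t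
    unfolding sin_prod_def by (subst prod.remove[of _ i]) (use Q[of t] in auto)
  have 2: "sin_prod \<omega> (\<theta>(i := \<theta> i + pi / 2)) (z + t *\<^sub>R axis i 1) = cos (\<omega> i * (z $ i + t) + \<theta> i) * Q" for t
    unfolding sin_prod_def
    by (subst prod.remove[of _ i]) (simp_all only: Q' finite UNIV_I, simp add: axis_def sin_add_pi_half flip: add.assoc)
  show ?thesis unfolding 1 2 by (auto intro!: derivative_eq_intros)
qed

lemma partial_sin_prod: "partial i (sin_prod \<omega> \<theta>) = (\<lambda>z. \<omega> i * sin_prod \<omega> (\<theta>(i := \<theta> i + pi / 2)) z)"
  by (intro ext partialI) (use DERIV_sin_prod[of \<omega> \<theta> _ i 0] in simp)

lemma sin_prod_Ck: "Ck k (sin_prod \<omega> \<theta>)"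
proof (induction k arbitrary: \<theta>)
  case 0
  then show ?case by (simp add: continuous_on_sin_prod)
next
  case (Suc k)
  have "Ck k (partial i (sin_prod \<omega> \<theta>))" for i
    unfolding partial_sin_prod using Ck_linear[OF Suc.IH Suc.IH, of "\<omega> i" _ 0] by simp
  moreover have "(\<lambda>t. sin_prod \<omega> \<theta> (z + t *\<^sub>R axis i 1)) differentiable (at 0)" for i z
    using DERIV_sin_prod real_differentiable_def by blast
  ultimately show ?case by (simp add: continuous_on_sin_prod)
qed

lemma partial2_sin_prod: "partial i (partial i (sin_prod \<omega> \<theta>)) z = - (\<omega> i)\<^sup>2 * sin_prod \<omega> \<theta> z"
proof -
  have "((\<lambda>t. \<omega> i * sin_prod \<omega> (\<theta>(i := \<theta> i + pi / 2)) (z + t *\<^sub>R axis i 1)) has_real_derivative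
     \<omega> i * (\<omega> i * sin_prod \<omega> (\<theta>(i := \<theta> i + pi)) z)) (at 0)"
    by (rule DERIV_cong[OF DERIV_cmult[OF DERIV_sin_prod]]) (simp add: add.commute)
  moreover have "sin_prod \<omega> (\<theta>(i := \<theta> i + pi)) z = - sin_prod \<omega> \<theta> z"
  proof -
    have "(\<Prod>j\<in>UNIV - {i}. sin (\<omega> j * z $ j + (\<theta>(i := \<theta> i + pi)) j)) = (\<Prod>j\<in>UNIV - {i}. sin (\<omega> j * z $ j + \<theta> j))"
      by (intro prod.cong) auto
    then show ?thesis unfolding sin_prod_def
      by (subst (1 2) prod.remove[of _ i]) (auto simp flip: add.assoc)
  qed
  ultimately show ?thesis
    unfolding partial_sin_prod by (subst partialI) (auto simp: power2_eq_square mult.assoc)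
qed

lemma Pop_sin_prod: "Pop \<alpha> (sin_prod \<omega> \<theta>) z = - (\<Sum>j\<in>UNIV. \<alpha> j * (\<omega> j)\<^sup>2) * sin_prod \<omega> \<theta> z"
  unfolding Pop_def partial2_sin_prod by (simp add: sum_distrib_left sum_negf mult_ac)

text \<open>The base point enters only the phases, on which the eigenvalue of P does not depend.
  This gives uniformity in \<open>z0\<close>.\<close>

lemma mode_fun_rescaled:
  "mode_fun b l m (z0 + \<kappa> *\<^sub>R x) =
     sin_prod (\<lambda>j. pi * real (m j) / l j * \<kappa>) (\<lambda>j. pi * real (m j) * z0 $ j / l j + (if b = Neumann then pi / 2 else 0)) x"
proof -
  have "pi * real (m j) * (z0 + \<kappa> *\<^sub>R x) $ j / l j = pi * real (m j) / l j * \<kappa> * x $ j + pi * real (m j) * z0 $ j / l j" for j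
    by (simp add: algebra_simps add_divide_distrib)
  then show ?thesis
    unfolding mode_fun_def sin_prod_def by (cases b) (simp_all only: bc.simps bc.distinct if_True if_False simp_thms add_0_right sin_add_pi_half flip: add.assoc)
qed

lemma Pop_eigen_sum:
  fixes g :: "'m \<Rightarrow> real^'n::finite \<Rightarrow> real"
  assumes "finite F" "\<And>m. m \<in> F \<Longrightarrow> \<forall>k. Ck k (g m)" "\<And>m z. m \<in> F \<Longrightarrow> Pop \<alpha> (g m) z = - a * g m z"
  shows "(\<forall>k. Ck k (\<lambda>x. \<Sum>m\<in>F. c m * g m x)) \<and> (\<forall>z. Pop \<alpha> (\<lambda>x. \<Sum>m\<in>F. c m * g m x) z = - a * (\<Sum>m\<in>F. c m * g m z))"
  using assms
proof (induction F)
  case empty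
  show ?case
    \<comment> \<open>The zero function is written as a trivial combination of radial waves, so that
      the linearity lemmas cover it.\<close>
    using Ck_linear[OF radial_Ck radial_Ck, of _ 0 "0 :: real^'n" 0 0 "0 :: real^'n" 0]
      Pop_linear[OF radial_Ck radial_Ck, of \<alpha> 0 "0 :: real^'n" 0 0 "0 :: real^'n" 0] by simp
next
  case (insert m F)
  then have IH: "\<And>k. Ck k (\<lambda>x. \<Sum>m\<in>F. c m * g m x)"
    "\<And>z. Pop \<alpha> (\<lambda>x. \<Sum>m\<in>F. c m * g m x) z = - a * (\<Sum>m\<in>F. c m * g m z)" by auto
  have eq: "(\<lambda>x. \<Sum>m\<in>insert m F. c m * g m x) = (\<lambda>x. c m * g m x + 1 * (\<Sum>m\<in>F. c m * g m x))"
    using insert.hyps by simp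
  show ?case unfolding eq
    using Ck_linear[of _ "g m" "\<lambda>x. \<Sum>m\<in>F. c m * g m x" "c m" 1]
      Pop_linear[of "g m" "\<lambda>x. \<Sum>m\<in>F. c m * g m x" \<alpha> "c m" 1] IH insert
    by (simp add: algebra_simps)
qed

section \<open>The quadric containing the rescaled frequencies\<close>

locale rational_quadric =
  fixes l :: "'n::finite \<Rightarrow> real" and T :: "real \<Rightarrow> real" and \<alpha> :: "'n \<Rightarrow> real"
  assumes l_pos: "\<And>j. 0 < l j"
    and T_add: "\<And>x y. T (x + y) = T x + T y"
    and T_scale: "\<And>q x. T (of_rat q * x) = of_rat q * T x"
    and \<alpha>_def: "\<And>j. \<alpha> j = (l j)\<^sup>2 * T (1 / (l j)\<^sup>2)"
begin

lemma T_sum: "T (\<Sum>j\<in>S. f j) = (\<Sum>j\<in>S. T (f j))"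
proof (induction S rule: infinite_finite_induct)
  have "T 0 = 0" using T_scale[of 0 0] by simp
  then show "T (sum f {}) = (\<Sum>j\<in>{}. T (f j))" "infinite A \<Longrightarrow> T (sum f A) = (\<Sum>j\<in>A. T (f j))" for A by auto
qed (simp add: T_add)

text \<open>Dividing by pi^2 leaves the rational factors m_j^2 in front of 1/l_j^2, through which T
  passes. The factor l_j^2 in \<alpha> turns the result into weights on squared frequencies. The
  right side depends on \<open>lam\<close> only, so all modes of an eigenspace share it.\<close>

lemma frequency_quadric:
  assumes "mode_eig l m = lam" "lam > 0"
  shows "(\<Sum>j\<in>UNIV. \<alpha> j * (pi * real (m j) / l j * (1 / sqrt lam))\<^sup>2) = pi\<^sup>2 / lam * T (lam / pi\<^sup>2)"
proof -
  have "lam / pi\<^sup>2 = (\<Sum>j\<in>UNIV. of_rat (of_nat ((m j)\<^sup>2)) * (1 / (l j)\<^sup>2))"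
    by (simp add: assms(1)[symmetric] mode_eig_def sum_divide_distrib power_divide power_mult_distrib of_rat_power)
  then have "T (lam / pi\<^sup>2) = (\<Sum>j\<in>UNIV. of_rat (of_nat ((m j)\<^sup>2)) * T (1 / (l j)\<^sup>2))"
    by (simp only: T_sum T_scale)
  then have "pi\<^sup>2 / lam * T (lam / pi\<^sup>2) = (\<Sum>j\<in>UNIV. pi\<^sup>2 / lam * (real (m j))\<^sup>2 * T (1 / (l j)\<^sup>2))"
    by (simp add: sum_distrib_left mult.assoc of_rat_power)
  also have "\<dots> = (\<Sum>j\<in>UNIV. \<alpha> j * (pi * real (m j) / l j * (1 / sqrt lam))\<^sup>2)"
    using assms(2) l_pos by (intro sum.cong refl) (simp add: \<alpha>_def power_mult_distrib power_divide less_imp_neq[symmetric])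
  finally show ?thesis by simp
qed

lemma frequency_quadric_bound:
  assumes "lam \<in> eigenvalues b l"
  shows "\<bar>pi\<^sup>2 / lam * T (lam / pi\<^sup>2)\<bar> \<le> (\<Sum>j\<in>UNIV. \<bar>\<alpha> j\<bar>)"
proof -
  obtain m where m: "mode_eig l m = lam" "lam > 0" using assms by (auto simp: eigenvalues_def)
  define \<omega> where "\<omega> j = (pi * real (m j) / l j * (1 / sqrt lam))\<^sup>2" for j
  have "sum \<omega> UNIV = mode_eig l m / lam"
    using m(2) unfolding mode_eig_def sum_divide_distrib \<omega>_def
    by (intro sum.cong refl) (simp add: power_mult_distrib power_divide)
  \<comment> \<open>The rescaling by 1 / sqrt lam puts the frequency vectors on the unit sphere;
    this replaces any bound on T.\<close>
  then have s: "sum \<omega> UNIV = 1" using m by simp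
  have \<omega>: "0 \<le> \<omega> j" "\<omega> j \<le> 1" for j
    using member_le_sum[of j UNIV \<omega>] s by (auto simp: \<omega>_def)
  have "\<bar>pi\<^sup>2 / lam * T (lam / pi\<^sup>2)\<bar> = \<bar>\<Sum>j\<in>UNIV. \<alpha> j * \<omega> j\<bar>"
    using frequency_quadric[OF m] by (simp add: \<omega>_def)
  also have "\<dots> \<le> (\<Sum>j\<in>UNIV. \<bar>\<alpha> j * \<omega> j\<bar>)" by (rule sum_abs)
  also have "\<dots> \<le> (\<Sum>j\<in>UNIV. \<bar>\<alpha> j\<bar>)"
    by (intro sum_mono) (use \<omega> in \<open>auto simp: abs_mult intro!: mult_left_le\<close>)
  finally show ?thesis .
qed

lemma Pop_rescaled_eigenfunction:
  assumes "lam \<in> eigenvalues b l" "u \<in> eigenspace b l lam"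
  shows "Ck k (\<lambda>x. u (z0 + (1 / sqrt lam) *\<^sub>R x))"
    "Pop \<alpha> (\<lambda>x. u (z0 + (1 / sqrt lam) *\<^sub>R x)) z = - (pi\<^sup>2 / lam * T (lam / pi\<^sup>2)) * u (z0 + (1 / sqrt lam) *\<^sub>R z)"
proof -
  obtain F c where F: "finite F" "\<And>m. m \<in> F \<Longrightarrow> mode_eig l m = lam"
    "u = (\<lambda>z. \<Sum>m\<in>F. c m * mode_fun b l m z)"
    using assms(2) unfolding eigenspace_def by blast
  have lam: "lam > 0" using assms(1) by (simp add: eigenvalues_def)
  let ?g = "\<lambda>m. sin_prod (\<lambda>j. pi * real (m j) / l j * (1 / sqrt lam))
     (\<lambda>j. pi * real (m j) * z0 $ j / l j + (if b = Neumann then pi / 2 else 0))"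
  have "Pop \<alpha> (?g m) z = - (pi\<^sup>2 / lam * T (lam / pi\<^sup>2)) * ?g m z" if "m \<in> F" for m z
    unfolding Pop_sin_prod frequency_quadric[OF F(2)[OF that] lam] ..
  from Pop_eigen_sum[where g = ?g, OF F(1) _ this, of c]
  show "Ck k (\<lambda>x. u (z0 + (1 / sqrt lam) *\<^sub>R x))"
    "Pop \<alpha> (\<lambda>x. u (z0 + (1 / sqrt lam) *\<^sub>R x)) z = - (pi\<^sup>2 / lam * T (lam / pi\<^sup>2)) * u (z0 + (1 / sqrt lam) *\<^sub>R z)"
    unfolding F(3) mode_fun_rescaled by (auto simp: sin_prod_Ck)
qed

end

section \<open>Supremum bounds and the iterated infimum\<close>

lemma weight_ge_1:
  fixes z :: "real^'n::finite"
  shows "(1 + norm z) powr ((real CARD('n) - 1) / 2) \<ge> 1"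
  by (intro ge_one_powr_ge_zero) (auto simp: Suc_leI)

lemma MWs_bounded:
  assumes "\<phi> \<in> MWs"
  obtains M where "\<And>z. \<bar>\<phi> z\<bar> \<le> M"
proof -
  obtain C where C: "\<And>z. (1 + norm z) powr ((real CARD('a) - 1) / 2) * \<bar>\<phi> z\<bar> \<le> C"
    using assms unfolding MWs_def by blast
  have "\<bar>\<phi> z\<bar> \<le> C" for z
    using mult_right_mono[OF weight_ge_1, of "\<bar>\<phi> z\<bar>" z] C[of z] by simp
  then show ?thesis using that by blast
qed

lemma eigenspace_bounded:
  assumes "u \<in> eigenspace b l lam"
  obtains M where "\<And>z. \<bar>u z\<bar> \<le> M"
proof -
  obtain F c where u: "u = (\<lambda>z. \<Sum>m\<in>F. c m * mode_fun b l m z)"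
    using assms unfolding eigenspace_def by blast
  have "\<bar>mode_fun b l m z\<bar> \<le> 1" for m z
    unfolding mode_fun_def abs_prod by (intro prod_le_1) (auto split: bc.split)
  then have "\<bar>u z\<bar> \<le> (\<Sum>m\<in>F. \<bar>c m\<bar>)" for z
    unfolding u by (intro order_trans[OF sum_abs] sum_mono) (auto simp: abs_mult intro!: mult_left_le)
  then show ?thesis using that by blast
qed

text \<open>The bound M serves only to make the supremum one of a bounded set of reals.\<close>

lemma C0_norm_on_upper:
  assumes "\<And>z. \<bar>f z\<bar> \<le> M" "x \<in> B"
  shows "\<bar>f x\<bar> \<le> C0_norm_on B f"
  unfolding C0_norm_on_def using assms by (intro cSUP_upper) (auto simp: bdd_above_def)

lemma C0_norm_on_least: "B \<noteq> {} \<Longrightarrow> (\<And>z. z \<in> B \<Longrightarrow> \<bar>f z\<bar> \<le> M) \<Longrightarrow> C0_norm_on B f \<le> M"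
  unfolding C0_norm_on_def by (rule cSUP_least)

lemma bounded_diff_eigenfunction:
  assumes "\<phi> \<in> MWs" "u \<in> eigenspace b l lam"
  obtains M where "\<And>x. \<bar>\<phi> x - u (z0 + \<kappa> *\<^sub>R x)\<bar> \<le> M"
proof -
  obtain M1 where "\<And>z. \<bar>\<phi> z\<bar> \<le> M1" using MWs_bounded[OF assms(1)] by blast
  moreover obtain M2 where "\<And>z. \<bar>u z\<bar> \<le> M2" using eigenspace_bounded[OF assms(2)] by blast
  ultimately have "\<bar>\<phi> x - u (z0 + \<kappa> *\<^sub>R x)\<bar> \<le> M1 + M2" for x
    by (intro order_trans[OF abs_triangle_ineq4] add_mono)
  then show ?thesis using that by blast
qed

text \<open>An infimum of reals behaves as expected only over nonempty families bounded below. Both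
  properties are checked at each of the three levels, after which positivity amounts to a uniform
  lower bound.\<close>

lemma N_set_iff:
  fixes l :: "'n::finite \<Rightarrow> real"
  assumes l: "\<And>j. 0 < l j" and B: "B \<noteq> {}"
  shows "\<phi> \<in> N_set b l B \<longleftrightarrow> \<phi> \<in> MWs \<and> (\<exists>\<delta>>0. \<forall>z0\<in>box_Q l. \<forall>lam\<in>eigenvalues b l. \<forall>u\<in>eigenspace b l lam.
     \<delta> \<le> C0_norm_on B (\<lambda>x. \<phi> x - u (z0 + (1 / sqrt lam) *\<^sub>R x)))"
proof (cases "\<phi> \<in> MWs")
  case \<phi>: True
  define D where "D z0 lam u = C0_norm_on B (\<lambda>x. \<phi> x - u (z0 + (1 / sqrt lam) *\<^sub>R x))" for z0 lam u
  have D: "0 \<le> D z0 lam u" if u: "u \<in> eigenspace b l lam" for z0 lam u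
  proof -
    obtain M where M: "\<And>x. \<bar>\<phi> x - u (z0 + (1 / sqrt lam) *\<^sub>R x)\<bar> \<le> M"
      using bounded_diff_eigenfunction[OF \<phi> u] by blast
    obtain x where "x \<in> B" using B by blast
    from order_trans[OF abs_ge_zero C0_norm_on_upper[of "\<lambda>x. \<phi> x - u (z0 + (1 / sqrt lam) *\<^sub>R x)", OF M this]]
    show ?thesis unfolding D_def .
  qed
  have ne: "box_Q l \<noteq> {}" "eigenvalues b l \<noteq> {}" "eigenspace b l lam \<noteq> {}" for lam
  proof -
    have "(\<chi> j. l j / 2) \<in> box_Q l" using l by (simp add: box_Q_def)
    then show "box_Q l \<noteq> {}" by blast
    \<comment> \<open>The mode with all indices 1 is admissible for both boundary conditions and has
      a positive eigenvalue.\<close>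
    have "0 < mode_eig l (\<lambda>_. 1)" unfolding mode_eig_def using l
      by (intro sum_pos) (auto simp: zero_less_divide_iff less_imp_neq[symmetric])
    moreover have "admissible b (\<lambda>_::'n. 1)" by (simp add: admissible_def)
    ultimately have "mode_eig l (\<lambda>_. 1) \<in> eigenvalues b l" unfolding eigenvalues_def by blast
    then show "eigenvalues b l \<noteq> {}" by blast
    have "(\<lambda>z. \<Sum>m\<in>{}. 0 * mode_fun b l m z) \<in> eigenspace b l lam"
      unfolding eigenspace_def mem_Collect_eq by (rule exI[of _ "{}"], rule exI[of _ "\<lambda>_. 0"]) simp
    then show "eigenspace b l lam \<noteq> {}" by blast
  qed
  have D1: "0 \<le> (INF u\<in>eigenspace b l lam. D z0 lam u)" for z0 lam
    by (intro cINF_greatest ne D)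
  have D2: "0 \<le> (INF lam\<in>eigenvalues b l. INF u\<in>eigenspace b l lam. D z0 lam u)" for z0
    by (intro cINF_greatest ne D1)
  let ?I = "INF z0\<in>box_Q l. INF lam\<in>eigenvalues b l. INF u\<in>eigenspace b l lam. D z0 lam u"
  have "0 < ?I \<longleftrightarrow> (\<exists>\<delta>>0. \<forall>z0\<in>box_Q l. \<forall>lam\<in>eigenvalues b l. \<forall>u\<in>eigenspace b l lam. \<delta> \<le> D z0 lam u)"
  proof
    assume I: "0 < ?I"
    have "?I \<le> D z0 lam u" if "z0 \<in> box_Q l" "lam \<in> eigenvalues b l" "u \<in> eigenspace b l lam" for z0 lam u
    proof -
      have "?I \<le> (INF lam\<in>eigenvalues b l. INF u\<in>eigenspace b l lam. D z0 lam u)"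
        by (rule cINF_lower[OF _ that(1)]) (rule bdd_belowI2[of _ 0], rule D2)
      also have "\<dots> \<le> (INF u\<in>eigenspace b l lam. D z0 lam u)"
        by (rule cINF_lower[OF _ that(2)]) (rule bdd_belowI2[of _ 0], rule D1)
      also have "\<dots> \<le> D z0 lam u"
        by (rule cINF_lower[OF _ that(3)]) (rule bdd_belowI2[of _ 0], rule D)
      finally show ?thesis .
    qed
    with I show "\<exists>\<delta>>0. \<forall>z0\<in>box_Q l. \<forall>lam\<in>eigenvalues b l. \<forall>u\<in>eigenspace b l lam. \<delta> \<le> D z0 lam u" by blast
  next
    assume "\<exists>\<delta>>0. \<forall>z0\<in>box_Q l. \<forall>lam\<in>eigenvalues b l. \<forall>u\<in>eigenspace b l lam. \<delta> \<le> D z0 lam u"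
    then obtain \<delta> where \<delta>: "\<delta> > 0" "\<And>z0 lam u. z0 \<in> box_Q l \<Longrightarrow> lam \<in> eigenvalues b l \<Longrightarrow> u \<in> eigenspace b l lam \<Longrightarrow> \<delta> \<le> D z0 lam u"
      by blast
    have "\<delta> \<le> ?I" by (intro cINF_greatest ne \<delta>(2))
    then show "0 < ?I" using \<delta>(1) by linarith
  qed
  then show ?thesis using \<phi> by (simp add: N_set_def D_def)
qed (simp add: N_set_def)

lemma MWs_linear:
  assumes "f \<in> MWs" "g \<in> MWs"
  shows "(\<lambda>z. a * f z + b * g z) \<in> MWs"
proof -
  let ?w = "\<lambda>z::real^'a. (1 + norm z) powr ((real CARD('a) - 1) / 2)"
  obtain C D where C: "\<And>z. ?w z * \<bar>f z\<bar> \<le> C" "\<And>z. ?w z * \<bar>g z\<bar> \<le> D"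
    using assms unfolding MWs_def by blast
  have "?w z * \<bar>a * f z + b * g z\<bar> \<le> \<bar>a\<bar> * C + \<bar>b\<bar> * D" for z
  proof -
    have "?w z * \<bar>a * f z + b * g z\<bar> \<le> ?w z * (\<bar>a * f z\<bar> + \<bar>b * g z\<bar>)"
      by (intro mult_left_mono abs_triangle_ineq) auto
    also have "\<dots> = \<bar>a\<bar> * (?w z * \<bar>f z\<bar>) + \<bar>b\<bar> * (?w z * \<bar>g z\<bar>)" by (simp add: abs_mult algebra_simps)
    also have "\<dots> \<le> \<bar>a\<bar> * C + \<bar>b\<bar> * D" by (intro add_mono mult_left_mono C) auto
    finally show ?thesis .
  qed
  moreover have "(\<lambda>z. a * f z + b * g z) \<in> MW" using assms by (intro MW_linear) (auto simp: MWs_def)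
  ultimately show ?thesis unfolding MWs_def by blast
qed

lemma MWs_Ck: "\<phi> \<in> MWs \<Longrightarrow> Ck k \<phi>"
  by (simp add: MWs_def MW_def smooth_def)

lemma abs_le_ws_norm:
  assumes "f \<in> MWs"
  shows "\<bar>f z\<bar> \<le> ws_norm f"
proof -
  let ?w = "\<lambda>z::real^'a. (1 + norm z) powr ((real CARD('a) - 1) / 2)"
  have "\<bar>f z\<bar> \<le> ?w z * \<bar>f z\<bar>" using mult_right_mono[OF weight_ge_1, of "\<bar>f z\<bar>" z] by simp
  also have "\<dots> \<le> ws_norm f"
    unfolding ws_norm_def using assms by (intro cSUP_upper) (auto simp: MWs_def bdd_above_def)
  finally show ?thesis .
qed

lemma open_N_set:
  fixes l :: "'n::finite \<Rightarrow> real"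
  assumes l: "\<And>j. 0 < l j" and B: "B \<noteq> {}"
  shows "open_in_MWs (N_set b l B)"
  unfolding open_in_MWs_def
proof (intro conjI ballI)
  show "N_set b l B \<subseteq> MWs" by (auto simp: N_set_def)
  fix \<phi> assume "\<phi> \<in> N_set b l B"
  then obtain \<delta> where \<phi>: "\<phi> \<in> MWs" and \<delta>: "\<delta> > 0"
    "\<And>z0 lam u. z0 \<in> box_Q l \<Longrightarrow> lam \<in> eigenvalues b l \<Longrightarrow> u \<in> eigenspace b l lam \<Longrightarrow>
       \<delta> \<le> C0_norm_on B (\<lambda>x. \<phi> x - u (z0 + (1 / sqrt lam) *\<^sub>R x))"
    unfolding N_set_iff[OF l B] by blast
  have "\<psi> \<in> N_set b l B" if \<psi>: "\<psi> \<in> MWs" "ws_norm (\<lambda>z. \<psi> z - \<phi> z) < \<delta> / 2" for \<psi>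
  proof -
    have "(\<lambda>z. \<psi> z - \<phi> z) \<in> MWs" using MWs_linear[OF \<psi>(1) \<phi>, of 1 "-1"] by simp
    then have d: "\<bar>\<psi> z - \<phi> z\<bar> \<le> \<delta> / 2" for z using abs_le_ws_norm[of "\<lambda>z. \<psi> z - \<phi> z" z] \<psi>(2) by linarith
    have "\<delta> / 2 \<le> C0_norm_on B (\<lambda>x. \<psi> x - u (z0 + (1 / sqrt lam) *\<^sub>R x))"
      if u: "z0 \<in> box_Q l" "lam \<in> eigenvalues b l" "u \<in> eigenspace b l lam" for z0 lam u
    proof -
      obtain M where M: "\<And>x. \<bar>\<psi> x - u (z0 + (1 / sqrt lam) *\<^sub>R x)\<bar> \<le> M"
        using bounded_diff_eigenfunction[OF \<psi>(1) u(3)] by blast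
      have "C0_norm_on B (\<lambda>x. \<phi> x - u (z0 + (1 / sqrt lam) *\<^sub>R x))
          \<le> C0_norm_on B (\<lambda>x. \<psi> x - u (z0 + (1 / sqrt lam) *\<^sub>R x)) + \<delta> / 2"
      proof (rule C0_norm_on_least[OF B])
        fix x assume "x \<in> B"
        from C0_norm_on_upper[of "\<lambda>x. \<psi> x - u (z0 + (1 / sqrt lam) *\<^sub>R x)", OF M this] d[of x]
        show "\<bar>\<phi> x - u (z0 + (1 / sqrt lam) *\<^sub>R x)\<bar> \<le> C0_norm_on B (\<lambda>x. \<psi> x - u (z0 + (1 / sqrt lam) *\<^sub>R x)) + \<delta> / 2"
          by linarith
      qed
      then show ?thesis using \<delta>(2)[OF u] by linarith
    qed
    then show ?thesis unfolding N_set_iff[OF l B] using \<psi>(1) \<delta>(1) half_gt_zero by blast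
  qed
  then show "\<exists>\<epsilon>>0. \<forall>\<psi>\<in>MWs. ws_norm (\<lambda>z. \<psi> z - \<phi> z) < \<epsilon> \<longrightarrow> \<psi> \<in> N_set b l B"
    using \<delta>(1) half_gt_zero by blast
qed

section \<open>Waves outside N and their perturbations\<close>

lemma (in rational_quadric) not_N_set_imp_Pop_eigen:
  assumes \<phi>: "\<phi> \<in> MWs" "\<phi> \<notin> N_set b l (ball c r)" and r: "r > 0"
  obtains a where "\<And>z. z \<in> ball c r \<Longrightarrow> Pop \<alpha> \<phi> z + a * \<phi> z = 0"
proof -
  define S where "S = (\<Sum>j\<in>UNIV. \<bar>\<alpha> j\<bar>)"
  have S0: "S \<ge> 0" by (simp add: S_def sum_nonneg)
  have ne: "ball c r \<noteq> {}" using r by simp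
  have "\<exists>a v. \<bar>a\<bar> \<le> S \<and> Ck 2 v \<and> (\<forall>z. Pop \<alpha> v z = - a * v z) \<and> (\<forall>x\<in>ball c r. \<bar>\<phi> x - v x\<bar> \<le> 1 / real (Suc n))" for n
  proof -
    have "0 < 1 / real (Suc n)" by simp
    then obtain z0 lam u where u: "lam \<in> eigenvalues b l" "u \<in> eigenspace b l lam"
      "C0_norm_on (ball c r) (\<lambda>x. \<phi> x - u (z0 + (1 / sqrt lam) *\<^sub>R x)) < 1 / real (Suc n)"
      using \<phi> unfolding N_set_iff[OF l_pos ne] by (meson not_le)
    obtain M where M: "\<And>x. \<bar>\<phi> x - u (z0 + (1 / sqrt lam) *\<^sub>R x)\<bar> \<le> M"
      using bounded_diff_eigenfunction[OF \<phi>(1) u(2)] by blast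
    have "\<bar>\<phi> x - u (z0 + (1 / sqrt lam) *\<^sub>R x)\<bar> \<le> 1 / real (Suc n)" if "x \<in> ball c r" for x
      using C0_norm_on_upper[of "\<lambda>x. \<phi> x - u (z0 + (1 / sqrt lam) *\<^sub>R x)", OF M that] u(3) by linarith
    then show ?thesis
      using frequency_quadric_bound[OF u(1)] Pop_rescaled_eigenfunction[OF u(1,2)] unfolding S_def
      by (intro exI[of _ "pi\<^sup>2 / lam * T (lam / pi\<^sup>2)"] exI[of _ "\<lambda>x. u (z0 + (1 / sqrt lam) *\<^sub>R x)"] conjI allI ballI) auto
  qed
  then obtain a v where a: "\<And>n. \<bar>a n\<bar> \<le> S" and v: "\<And>n. Ck 2 (v n)" "\<And>n z. Pop \<alpha> (v n) z = - a n * v n z"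
    and close: "\<And>n x. x \<in> ball c r \<Longrightarrow> \<bar>\<phi> x - v n x\<bar> \<le> 1 / real (Suc n)"
    by metis
  \<comment> \<open>The approximating eigenfunctions may belong to different eigenvalues, so the
    scalars vary with n; a limit exists along a subsequence.\<close>
  have "\<forall>n. a n \<in> {-S..S}" using a by (auto simp: abs_le_iff) (metis minus_le_iff)
  then obtain a0 \<sigma> where \<sigma>: "strict_mono \<sigma>" "(a \<circ> \<sigma>) \<longlonglongrightarrow> a0"
    using compact_Icc[of "-S" S] unfolding compact_def by blast
  have "Pop \<alpha> \<phi> x + a0 * \<phi> x = 0" if x: "x \<in> ball c r" for x
  proof (rule bump_integral_zero_imp_zero[of "\<lambda>z. Pop \<alpha> \<phi> z + a0 * \<phi> z" "ball c r"])
    note C\<phi> = MWs_Ck[OF \<phi>(1), of 2]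
    show "continuous_on UNIV (\<lambda>z. Pop \<alpha> \<phi> z + a0 * \<phi> z)"
      by (intro continuous_intros continuous_on_Pop C\<phi> Ck_2D(3))
    fix \<rho> :: real assume \<rho>: "\<rho> > 0" "cball x \<rho> \<subseteq> ball c r"
    define I where "I f = (LINT z|lborel. bump 3 x \<rho> z * f z)" for f
    have I_add: "I (\<lambda>z. s * f z + t * g z) = s * I f + t * I g" if "continuous_on UNIV f" "continuous_on UNIV g" for f g s t
      using integrable_bump_mult[OF \<rho>(1), of _ x] that unfolding I_def by (simp add: distrib_left mult.left_commute)
    have I_Pop: "I (Pop \<alpha> f) = (\<Sum>i\<in>UNIV. \<alpha> i * I (partial i (partial i f)))" if "Ck 2 f" for f
    proof -
      have "I (Pop \<alpha> f) = (LINT z|lborel. (\<Sum>i\<in>UNIV. \<alpha> i * (bump 3 x \<rho> z * partial i (partial i f) z)))"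
        by (simp add: I_def Pop_def sum_distrib_left mult.left_commute)
      then show ?thesis
        using integrable_bump_mult[OF \<rho>(1) Ck_2D(5)[OF that], of x] by (simp add: I_def)
    qed
    obtain C where C: "C > 0" "\<And>f i \<delta>. Ck 2 f \<Longrightarrow> (\<And>z. z \<in> cball x \<rho> \<Longrightarrow> \<bar>f z\<bar> \<le> \<delta>) \<Longrightarrow> \<bar>I (partial i (partial i f))\<bar> \<le> C * \<delta>"
      using integral_bump_partial2_bound[OF \<rho>(1), of x] unfolding I_def by blast
    define D where "D = I (\<lambda>z. 1)"
    have I_bound: "\<bar>I f\<bar> \<le> D * \<delta>" if f: "continuous_on UNIV f" "\<And>z. z \<in> cball x \<rho> \<Longrightarrow> \<bar>f z\<bar> \<le> \<delta>" for f \<delta>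
    proof -
      have "\<bar>I f\<bar> \<le> (LINT z|lborel. \<bar>bump 3 x \<rho> z * f z\<bar>)" unfolding I_def by (rule integral_abs_bound)
      also have "\<dots> \<le> (LINT z|lborel. bump 3 x \<rho> z * \<delta>)"
      proof (rule integral_mono)
        show "integrable lborel (\<lambda>z. bump 3 x \<rho> z * \<delta>)" by (rule integrable_bump_mult[OF \<rho>(1)]) simp
        show "integrable lborel (\<lambda>z. \<bar>bump 3 x \<rho> z * f z\<bar>)" using integrable_bump_mult[OF \<rho>(1) f(1)] by (rule integrable_abs)
        show "\<bar>bump 3 x \<rho> z * f z\<bar> \<le> bump 3 x \<rho> z * \<delta>" for z
        proof (cases "z \<in> cball x \<rho>")
          case True
          have "0 \<le> bump 3 x \<rho> z" by (simp add: bump_def)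
          then show ?thesis using f(2)[OF True] by (simp add: abs_mult mult_left_mono)
        next
          case False
          then show ?thesis using bump_eq_0[OF \<rho>(1), of 3 z x] by simp
        qed
      qed
      finally show ?thesis by (simp add: D_def I_def)
    qed
    have bound: "\<bar>I (Pop \<alpha> \<phi>) + a n * I \<phi>\<bar> \<le> (S * C + S * D) * (1 / real (Suc n))" for n
    proof -
      \<comment> \<open>Since \<open>v n\<close> satisfies the equation exactly with scalar
        \<open>a n\<close>, the defect of \<phi> equals that of w, which is uniformly small on the
        support of the bump.\<close>
      define w where "w z = 1 * \<phi> z + (-1) * v n z" for z
      have w: "Ck 2 w" unfolding w_def by (intro Ck_linear C\<phi> v)
      have wb: "\<bar>w z\<bar> \<le> 1 / real (Suc n)" if "z \<in> cball x \<rho>" for z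
        using close[of z n] that \<rho>(2) by (auto simp: w_def)
      have "Pop \<alpha> w = (\<lambda>z. 1 * Pop \<alpha> \<phi> z + a n * v n z)"
        unfolding w_def by (rule ext, subst Pop_linear[OF C\<phi> v(1)]) (simp add: v(2))
      then have "I (Pop \<alpha> w) = I (Pop \<alpha> \<phi>) + a n * I (v n)"
        using I_add[where f = "Pop \<alpha> \<phi>" and g = "v n" and s = 1 and t = "a n", OF continuous_on_Pop[OF C\<phi>] Ck_2D(3)[OF v(1)]] by simp
      moreover have "I w = I \<phi> - I (v n)"
        unfolding w_def using I_add[where f = \<phi> and g = "v n" and s = 1 and t = "- 1", OF Ck_2D(3)[OF C\<phi>] Ck_2D(3)[OF v(1)]] by simp
      ultimately have "I (Pop \<alpha> \<phi>) + a n * I \<phi> = I (Pop \<alpha> w) + a n * I w"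
        by (simp add: right_diff_distrib)
      then have "\<bar>I (Pop \<alpha> \<phi>) + a n * I \<phi>\<bar> \<le> \<bar>I (Pop \<alpha> w)\<bar> + \<bar>a n\<bar> * \<bar>I w\<bar>"
        using abs_triangle_ineq[of "I (Pop \<alpha> w)" "a n * I w"] by (simp add: abs_mult)
      also have "\<bar>I (Pop \<alpha> w)\<bar> \<le> (\<Sum>i\<in>UNIV. \<bar>\<alpha> i\<bar> * (C * (1 / real (Suc n))))"
        unfolding I_Pop[OF w] by (intro order_trans[OF sum_abs] sum_mono) (simp only: abs_mult, intro mult_left_mono C(2) w wb, auto)
      also have "\<dots> = S * (C * (1 / real (Suc n)))" unfolding S_def by (rule sum_distrib_right[symmetric])
      also have "\<bar>a n\<bar> * \<bar>I w\<bar> \<le> S * (D * (1 / real (Suc n)))"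
        by (intro mult_mono a I_bound Ck_2D(3)[OF w] wb S0) auto
      finally show ?thesis by (simp add: algebra_simps)
    qed
    have "(\<lambda>n. I (Pop \<alpha> \<phi>) + a (\<sigma> n) * I \<phi>) \<longlonglongrightarrow> 0"
    proof (rule Lim_null_comparison[OF always_eventually], rule allI)
      show "norm (I (Pop \<alpha> \<phi>) + a (\<sigma> n) * I \<phi>) \<le> (S * C + S * D) * (1 / real (Suc (\<sigma> n)))" for n
        using bound by simp
      have "(\<lambda>n. 1 / real (Suc n)) \<longlonglongrightarrow> 0" using LIMSEQ_inverse_real_of_nat by (simp add: inverse_eq_divide)
      from LIMSEQ_subseq_LIMSEQ[OF this \<sigma>(1)]
      show "(\<lambda>n. (S * C + S * D) * (1 / real (Suc (\<sigma> n)))) \<longlonglongrightarrow> 0"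
        using tendsto_mult_right_zero unfolding comp_def by blast
    qed
    moreover have "(\<lambda>n. I (Pop \<alpha> \<phi>) + a (\<sigma> n) * I \<phi>) \<longlonglongrightarrow> I (Pop \<alpha> \<phi>) + a0 * I \<phi>"
      using \<sigma>(2) unfolding comp_def by (intro tendsto_intros)
    ultimately have "I (Pop \<alpha> \<phi>) + a0 * I \<phi> = 0" using LIMSEQ_unique by blast
    then show "(LINT z|lborel. bump 3 x \<rho> z * (Pop \<alpha> \<phi> z + a0 * \<phi> z)) = 0"
      using I_add[where f = "Pop \<alpha> \<phi>" and g = \<phi> and s = 1 and t = a0, OF continuous_on_Pop[OF C\<phi>] Ck_2D(3)[OF C\<phi>]] by (simp add: I_def)
  qed (use x in auto)
  then show ?thesis using that by blast
qed

text \<open>If both \<open>\<phi>\<close> and \<open>\<phi> + t \<chi>\<close> were eigenfunctions of P, then \<open>P \<chi>\<close> would be a multiple of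
  \<open>\<chi>\<close> (equal eigenvalues), or \<open>\<phi>\<close> would lie in the span of \<open>P \<chi>\<close> and \<open>\<chi>\<close>; applying P to the
  latter relation makes \<open>\<chi>, P \<chi>, P\<^sup>2 \<chi>\<close> linearly dependent.\<close>

lemma (in rational_quadric) radial_perturbation_in_N_set:
  assumes jk: "j \<noteq> k" "\<alpha> k = 1" "\<alpha> j = 0" and r: "r > 0"
    and \<phi>: "\<phi> \<in> MWs" "\<phi> \<notin> N_set b l (ball c r)" and t: "t \<noteq> 0"
  shows "(\<lambda>z. 1 * \<phi> z + t * radial c 0 z) \<in> N_set b l (ball c r)" (is "?\<psi> \<in> _")
proof (rule ccontr)
  let ?P = "Pop \<alpha>" and ?\<chi> = "radial c 0"
  assume nN: "?\<psi> \<notin> N_set b l (ball c r)"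
  have \<psi>: "?\<psi> \<in> MWs" by (rule MWs_linear[OF \<phi>(1) radial_MWs])
  obtain a where a: "\<And>z. z \<in> ball c r \<Longrightarrow> ?P \<phi> z + a * \<phi> z = 0"
    using not_N_set_imp_Pop_eigen[OF \<phi> r] by blast
  obtain a' where a': "\<And>z. z \<in> ball c r \<Longrightarrow> ?P ?\<psi> z + a' * ?\<psi> z = 0"
    using not_N_set_imp_Pop_eigen[OF \<psi> nN r] by blast
  \<comment> \<open>The difference of the two eigenvalue equations, in which P of \<phi>
    cancels.\<close>
  have lin: "(a - a') * \<phi> z = t * ?P ?\<chi> z + a' * t * ?\<chi> z" if "z \<in> ball c r" for z
    using a[OF that] a'[OF that] unfolding Pop_linear[OF MWs_Ck[OF \<phi>(1)] radial_Ck] by (simp add: algebra_simps)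
  show False
  proof (cases "a = a'")
    case True
    then have "0 * ?P (?P ?\<chi>) z + t * ?P ?\<chi> z + a' * t * ?\<chi> z = 0" if "z \<in> ball c r" for z
      using lin[OF that] by simp
    from radial_Pop_independent(2)[OF jk r this] t show False by simp
  next
    case False
    define \<beta> \<gamma> where "\<beta> = t / (a - a')" and "\<gamma> = a' * t / (a - a')"
    have \<phi>eq: "\<phi> z = \<beta> * ?P ?\<chi> z + \<gamma> * ?\<chi> z" if "z \<in> ball c r" for z
    proof -
      have "\<phi> z = (a - a') * \<phi> z / (a - a')" using False by simp
      then show ?thesis unfolding lin[OF that] by (simp add: \<beta>_def \<gamma>_def add_divide_distrib)
    qed
    have "\<beta> * ?P (?P ?\<chi>) z + (\<gamma> + a * \<beta>) * ?P ?\<chi> z + a * \<gamma> * ?\<chi> z = 0" if z: "z \<in> ball c r" for z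
    proof -
      have "?P \<phi> z = ?P (\<lambda>z. \<beta> * ?P ?\<chi> z + \<gamma> * ?\<chi> z) z"
        by (rule Pop_cong_open[of "ball c r"]) (use z \<phi>eq in auto)
      then show ?thesis using a[OF z] \<phi>eq[OF z]
        unfolding Pop_linear[OF Pop_radial_Ck radial_Ck] by (simp add: algebra_simps)
    qed
    from radial_Pop_independent(1)[OF jk r this] t False show False by (simp add: \<beta>_def)
  qed
qed

text \<open>For a wave outside N, every nonzero multiple of the radial wave is a perturbation into
  N, so the multiple can be taken as small as desired.\<close>

lemma (in rational_quadric) dense_N_set:
  assumes "j \<noteq> k" "\<alpha> k = 1" "\<alpha> j = 0" "r > 0"
  shows "dense_in_MWs (N_set b l (ball c r))"
  unfolding dense_in_MWs_def
proof (intro ballI allI impI)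
  fix \<phi> :: "real^'n \<Rightarrow> real" and \<epsilon> :: real
  assume \<phi>: "\<phi> \<in> MWs" and \<epsilon>: "\<epsilon> > 0"
  show "\<exists>\<psi>\<in>N_set b l (ball c r). ws_norm (\<lambda>z. \<psi> z - \<phi> z) < \<epsilon>"
  proof (cases "\<phi> \<in> N_set b l (ball c r)")
    case True
    then show ?thesis using \<epsilon> by (intro bexI[of _ \<phi>]) (auto simp: ws_norm_def)
  next
    case False
    let ?w = "\<lambda>z::real^'n. (1 + norm z) powr ((real CARD('n) - 1) / 2)"
    obtain C where C: "\<And>z. ?w z * \<bar>radial c 0 z\<bar> \<le> C" using radial_MWs[of c] unfolding MWs_def by blast
    have C0: "C \<ge> 0" by (rule order_trans[OF _ C[of 0]]) simp
    \<comment> \<open>The 1 in the denominator keeps it positive when C = 0 and makes the final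
      estimate strict.\<close>
    define t where "t = \<epsilon> / (C + 1)"
    have t: "t > 0" using \<epsilon> C0 by (simp add: t_def)
    have "ws_norm (\<lambda>z. (1 * \<phi> z + t * radial c 0 z) - \<phi> z) \<le> t * C"
      unfolding ws_norm_def
    proof (rule cSUP_least)
      fix z
      show "?w z * \<bar>1 * \<phi> z + t * radial c 0 z - \<phi> z\<bar> \<le> t * C"
        using mult_left_mono[OF C[of z], of t] t by (simp add: abs_mult algebra_simps)
    qed simp
    also have "t * C < \<epsilon>" using \<epsilon> C0 by (simp add: t_def field_simps)
    finally show ?thesis
      using radial_perturbation_in_N_set[OF assms \<phi> False, of t] t
      by (intro bexI[of _ "\<lambda>z. 1 * \<phi> z + t * radial c 0 z"]) simp_all
  qed
qed

theorem theorem5p4: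
  fixes l :: "'n::finite \<Rightarrow> real" and k :: 'n and c :: "real^'n" and r :: real and b :: bc
  assumes "CARD('n) \<ge> 2"
    and "\<forall>j. 0 < l j"
    and "l k = 1"
    and "\<exists>j. j \<noteq> k \<and> (l j)\<^sup>2 \<notin> \<rat>"
    and "0 < r"
  shows "open_in_MWs (N_set b l (ball c r)) \<and> dense_in_MWs (N_set b l (ball c r))"
proof
  have l: "\<And>j. 0 < l j" using assms(2) by blast
  show "open_in_MWs (N_set b l (ball c r))" by (rule open_N_set) (use l assms(5) in auto)
  obtain j where j: "j \<noteq> k" "(l j)\<^sup>2 \<notin> \<rat>" using assms(4) by blast
  have "1 / (l j)\<^sup>2 \<notin> \<rat>"
    using j(2) Rats_divide[OF Rats_1, of "1 / (l j)\<^sup>2"] by auto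
  then obtain T :: "real \<Rightarrow> real" where T: "T 1 = 1" "T (1 / (l j)\<^sup>2) = 0"
    "\<And>x y. T (x + y) = T x + T y" "\<And>q x. T (of_rat q * x) = of_rat q * T x"
    using rational_functional by blast
  define \<alpha> where "\<alpha> i = (l i)\<^sup>2 * T (1 / (l i)\<^sup>2)" for i
  interpret rational_quadric l T \<alpha>
    by unfold_locales (use l T \<alpha>_def in auto)
  show "dense_in_MWs (N_set b l (ball c r))"
    \<comment> \<open>The unit side gives \<alpha>_k = T(1) = 1, and the choice of T gives
      \<alpha>_j = 0.\<close>
    by (rule dense_N_set[OF j(1)]) (use assms(3,5) T in \<open>auto simp: \<alpha>_def\<close>)
qed

end
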